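(* Let $n\ge 1$, let $\alpha\in[0,\frac{\pi}{2})$, let $0\le v\le 1$, let $0<m\le M$ be real numbers, and put $h=M/m$. Let $A,B\in\mathbb{M}_n$ with $W(A),W(B)\subset S_\alpha$. Then for any unitarily invariant norm $\|\cdot\|_u$ on $\mathbb{M}_n$ the following hold. (i) If $0<mI_n\le \Re(A^{-1}),\,\Re(B^{-1})\le MI_n$ (that is, both $\Re(A^{-1})$ and $\Re(B^{-1})$ lie between $mI_n$ and $MI_n$), then $$\|A\sharp_vB\|_u\le \sec^{5}(\alpha)\,K(h)\,\|A!_vB\|_u.$$ (ii) If $0<mI_n\le \Re(A),\,\Re(B)\le MI_n$, then $$\|A\sharp_vB\|_u\ge \cos^{5}(\alpha)\,K^{-1}(h)\,\|A\nabla_vB\|_u.$$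
   Context: $\mathbb{M}_n$ is the algebra of $n\times n$ complex matrices, $I_n$ the identity. For $A\in\mathbb{M}_n$, $\Re A=\frac{A+A^*}{2}$ and $\Im A=\frac{A-A^*}{2i}$. Inequalities between Hermitian matrices are in the Loewner order. The numerical range is $W(A)=\{x^*Ax: x\in\mathbb{C}^n,\ x^*x=1\}$. For $\alpha\in[0,\frac{\pi}{2})$, $S_\alpha=\{z\in\mathbb{C}:\Re z>0,\ |\Im z|\le(\Re z)\tan\alpha\}$. If $W(A)\subset S_\alpha$ then $A$ is invertible, $\Re A$ is positive definite and $W(A^{-1})\subset S_\alpha$. For $A,B$ with $\Re A,\Re B$ positive definite and $v\in[0,1]$: $A\nabla_vB=(1-v)A+vB$; $A!_vB=\big((1-v)A^{-1}+vB^{-1}\big)^{-1}$; and the weighted geometric mean is $A\sharp_vB=\frac{\sin v\pi}{\pi}\int_0^\infty s^{v-1}(A^{-1}+sB^{-1})^{-1}\,ds$ for $0<v<1$, with $A\sharp_0B=A$ and $A\sharp_1B=B$. The Kantorovich constant is $K(h)=\frac{(h+1)^2}{4h}$, where $h=M/m\ge 1$; $K^{-1}(h)=1/K(h)$. A norm $\|\cdot\|_u$ on $\mathbb{M}_n$ is unitarily invariant if $\|X\|_u=\|UXV\|_u$ for all unitary $U,V\in\mathbb{M}_n$ and all $X\in\mathbb{M}_n$. *)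

theory Defs
  imports "HOL-Analysis.Analysis"
begin

text \<open>
  The algebra of \<open>n \<times> n\<close> complex matrices is the type \<open>complex ^ 'n ^ 'n\<close>
  with \<open>n = CARD('n)\<close>; real multiples of matrices are written with \<open>*\<^sub>R\<close>, and
  \<open>mat c\<close> is \<open>c\<close> times the identity matrix.
\<close>

type_synonym 'n cmat = "complex ^ 'n ^ 'n"

definition conj_transpose :: "('n::finite) cmat \<Rightarrow> 'n cmat" where
  "conj_transpose A = (\<chi> i j. cnj (A $ j $ i))"

definition hermitian :: "('n::finite) cmat \<Rightarrow> bool" where
  "hermitian A \<longleftrightarrow> conj_transpose A = A"

definition unitary :: "('n::finite) cmat \<Rightarrow> bool" where
  "unitary U \<longleftrightarrow> U ** conj_transpose U = mat 1 \<and> conj_transpose U ** U = mat 1"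

definition mat_Re :: "('n::finite) cmat \<Rightarrow> 'n cmat" where
  "mat_Re A = (1 / 2) *\<^sub>R (A + conj_transpose A)"

text \<open>\<open>hdot x y\<close> is \<open>x\<^sup>* y\<close>, conjugate-linear in the first argument
  (the inner product provided by the library on this type is the real one).\<close>

definition hdot :: "complex ^ ('n::finite) \<Rightarrow> complex ^ 'n \<Rightarrow> complex" where
  "hdot x y = (\<Sum>i\<in>UNIV. cnj (x $ i) * y $ i)"

definition numerical_range :: "('n::finite) cmat \<Rightarrow> complex set" where
  "numerical_range A = {hdot x (A *v x) | x. hdot x x = 1}"

definition sector :: "real \<Rightarrow> complex set" where
  "sector \<alpha> = {z. Re z > 0 \<and> \<bar>Im z\<bar> \<le> Re z * tan \<alpha>}"

text \<open>For Hermitian \<open>A\<close> the number \<open>x\<^sup>* A x\<close> is real, so taking \<open>Re\<close> loses nothing.\<close>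

definition pos_semidef :: "('n::finite) cmat \<Rightarrow> bool" where
  "pos_semidef A \<longleftrightarrow> hermitian A \<and> (\<forall>x. 0 \<le> Re (hdot x (A *v x)))"

definition loewner_le :: "('n::finite) cmat \<Rightarrow> 'n cmat \<Rightarrow> bool" (infix "\<preceq>" 50) where
  "X \<preceq> Y \<longleftrightarrow> hermitian X \<and> hermitian Y \<and> pos_semidef (Y - X)"

definition arith_mean :: "real \<Rightarrow> ('n::finite) cmat \<Rightarrow> 'n cmat \<Rightarrow> 'n cmat" where
  "arith_mean v A B = (1 - v) *\<^sub>R A + v *\<^sub>R B"

definition harm_mean :: "real \<Rightarrow> ('n::finite) cmat \<Rightarrow> 'n cmat \<Rightarrow> 'n cmat" where
  "harm_mean v A B = matrix_inv ((1 - v) *\<^sub>R matrix_inv A + v *\<^sub>R matrix_inv B)"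

definition geom_mean :: "real \<Rightarrow> ('n::finite) cmat \<Rightarrow> 'n cmat \<Rightarrow> 'n cmat" where
  "geom_mean v A B =
     (if v = 0 then A
      else if v = 1 then B
      else (sin (v * pi) / pi) *\<^sub>R
        (LBINT s:{0<..}. (s powr (v - 1)) *\<^sub>R matrix_inv (matrix_inv A + s *\<^sub>R matrix_inv B)))"

definition kantorovich :: "real \<Rightarrow> real" where
  "kantorovich h = (h + 1)\<^sup>2 / (4 * h)"

definition sec :: "real \<Rightarrow> real" where
  "sec x = 1 / cos x"

text \<open>Norms on the complex vector space of matrices: homogeneity is with respect to complex
  scalars, \<open>mat c ** X\<close> being the multiple \<open>c X\<close>.\<close>

definition is_matrix_norm :: "(('n::finite) cmat \<Rightarrow> real) \<Rightarrow> bool" where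
  "is_matrix_norm N \<longleftrightarrow>
     (\<forall>X. 0 \<le> N X) \<and>
     (\<forall>X. N X = 0 \<longleftrightarrow> X = 0) \<and>
     (\<forall>c X. N (mat c ** X) = cmod c * N X) \<and>
     (\<forall>X Y. N (X + Y) \<le> N X + N Y)"

definition unitarily_invariant_norm :: "(('n::finite) cmat \<Rightarrow> real) \<Rightarrow> bool" where
  "unitarily_invariant_norm N \<longleftrightarrow>
     is_matrix_norm N \<and>
     (\<forall>U V X. unitary U \<longrightarrow> unitary V \<longrightarrow> N X = N (U ** X ** V))"

end

theory Submission
  imports Defs
begin

text \<open>
  For a sectorial matrix \<open>A\<close> write \<open>q\<^sub>A x = x \<bullet> (A *v x) = Re (x\<^sup>* A x)\<close>, the quadratic form of its real part.
  The proof reduces both norm inequalities to inequalities between such forms.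

  The reduction rests on two facts.  If \<open>y \<bullet> (A *v x) \<le> (q\<^sub>H x + q\<^sub>H y) / 2\<close> for all \<open>x\<close> and \<open>y\<close>,
  then \<open>N A \<le> N H\<close> for every unitarily invariant norm (\<open>norm_le_if_form_le\<close>): apply the hypothesis to the
  singular vectors of \<open>A\<close>.  And a matrix with numerical range in the sector satisfies
  \<open>y \<bullet> (A *v x) \<le> sec \<alpha> (q\<^sub>A x + q\<^sub>A y) / 2\<close> (\<open>sectorial_form_le\<close>).  Hence \<open>q\<^sub>A \<le> c q\<^sub>H\<close> implies
  \<open>N A \<le> sec \<alpha> c N H\<close>.

  The forms are compared under the integral that defines the geometric mean.  The forms of the
  inverses of \<open>A\<inverse> + s B\<inverse>\<close> are estimated by means of
  \<open>2 z \<bullet> w - q\<^sub>P z \<le> ((M + m) (w \<bullet> w) - q\<^sub>P w) / (M m)\<close>, valid for \<open>m I \<le> Re P \<le> M I\<close>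
  (\<open>kantorovich_tangent\<close>).  The resulting bounds have the shape \<open>(a + s b) / (1 + s)\<^sup>2\<close>, and these integrate to
  \<open>(1 - v) a + v b\<close> (\<open>functional_geom_mean_le\<close>, through beta integrals).  So the geometric mean is compared with
  an expression in an arithmetic mean \<open>C\<close>, either of \<open>A\<inverse>\<close> and \<open>B\<inverse>\<close> or of \<open>A\<close> and \<open>B\<close>, and what is left is an
  arithmetic-geometric mean inequality for \<open>C\<close> in which \<open>((M + m) / 2)\<^sup>2 / (M m) = K(h)\<close> appears.

  This gives the factors \<open>sec\<^sup>3 \<alpha> K(h)\<close> in the comparison with the harmonic mean (\<open>geom_mean_le_harm_mean\<close>)
  and \<open>cos \<alpha> K(h)\<inverse>\<close> in the comparison with the arithmetic mean (\<open>arith_mean_le_geom_mean\<close>); the fifth powers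
  follow from \<open>cos \<alpha> \<le> 1\<close>.
\<close>

section \<open>The Hermitian form and adjoints\<close>

lemma hdot_add_right: "hdot x (y + z) = hdot x y + hdot x z"
  and hdot_add_left: "hdot (x + y) z = hdot x z + hdot y z"
  and hdot_diff_right: "hdot x (y - z) = hdot x y - hdot x z"
  and hdot_diff_left: "hdot (x - y) z = hdot x z - hdot y z"
  and hdot_scale_right: "hdot x (c *s y) = c * hdot x y"
  and hdot_scale_left: "hdot (c *s x) y = cnj c * hdot x y"
  and hdot_scaleR_right: "hdot x (r *\<^sub>R y) = of_real r * hdot x y"
  and hdot_scaleR_left: "hdot (r *\<^sub>R x) y = of_real r * hdot x y"
  by (simp_all add: hdot_def algebra_simps sum.distrib sum_subtractf sum_distrib_left scaleR_conv_of_real[where 'a = complex])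

lemma cnj_hdot: "cnj (hdot x y) = hdot y x"
  by (simp add: hdot_def mult.commute)

text \<open>
  Quadratic inequalities below are written with the real inner product, so that
  \<open>x \<bullet> (A *v x)\<close> is the quadratic form of the real part of \<open>A\<close>.
\<close>

lemma Re_hdot: "Re (hdot x y) = x \<bullet> y"
  by (simp add: hdot_def inner_vec_def inner_complex_def)

lemma hdot_self: "hdot x x = of_real (x \<bullet> x)"
proof -
  have "Im (hdot x x) = 0"
    using cnj_hdot[of x x] by (simp add: complex_eq_iff)
  then show ?thesis by (simp add: complex_eq_iff Re_hdot)
qed

lemma hdot_conj_transpose: "hdot x (A *v y) = hdot (conj_transpose A *v x) y"
proof -
  have "hdot x (A *v y) = (\<Sum>i\<in>UNIV. \<Sum>j\<in>UNIV. cnj (x $ i) * (A $ i $ j * y $ j))"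
    by (simp add: hdot_def matrix_vector_mult_def sum_distrib_left)
  also have "\<dots> = (\<Sum>j\<in>UNIV. \<Sum>i\<in>UNIV. cnj (x $ i) * (A $ i $ j * y $ j))"
    by (rule sum.swap)
  also have "\<dots> = hdot (conj_transpose A *v x) y"
    by (simp add: hdot_def matrix_vector_mult_def conj_transpose_def sum_distrib_right sum_distrib_left mult_ac)
  finally show ?thesis .
qed

lemma inner_conj_transpose: "x \<bullet> (A *v y) = (conj_transpose A *v x) \<bullet> y" for A :: "'n::finite cmat"
  by (metis Re_hdot hdot_conj_transpose)

lemma scaleR_matrix_vector: "(r *\<^sub>R A) *v x = r *\<^sub>R (A *v x)" for A :: "'n::finite cmat"
  by (simp add: matrix_vector_mult_def vec_eq_iff scaleR_sum_right)

lemma vec_scale_matrix: "A *v (c *s x) = c *s (A *v x)" for A :: "'n::finite cmat"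
  by (simp add: matrix_vector_mult_def vec_eq_iff sum_distrib_left mult_ac)

lemma matrix_vector_scaleR: "A *v (r *\<^sub>R x) = r *\<^sub>R (A *v x)" for A :: "'n::finite cmat"
  by (simp add: linear_scale[OF matrix_vector_mul_linear])

lemma conj_transpose_mult: "conj_transpose (A ** B) = conj_transpose B ** conj_transpose A"
  by (simp add: conj_transpose_def matrix_matrix_mult_def vec_eq_iff mult.commute)

lemma conj_transpose_conj_transpose [simp]: "conj_transpose (conj_transpose A) = A"
  by (simp add: conj_transpose_def vec_eq_iff)

lemma conj_transpose_mat_1 [simp]: "conj_transpose (mat 1) = mat 1"
  by (simp add: conj_transpose_def vec_eq_iff mat_def)

lemma unitary_mult: "unitary U \<Longrightarrow> unitary V \<Longrightarrow> unitary (U ** V)"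
  unfolding unitary_def conj_transpose_mult
  by (metis matrix_mul_assoc matrix_mul_rid)

lemma unitary_conj_transpose: "unitary U \<Longrightarrow> unitary (conj_transpose U)"
  by (simp add: unitary_def)

lemma unitary_mat_1: "unitary (mat 1)"
  by (simp add: unitary_def)

lemma mult_axis_component: "(A *v axis j 1) $ i = A $ i $ j" for A :: "'n::finite cmat"
  by (simp add: matrix_vector_mult_def axis_def if_distrib[of "\<lambda>x. _ * x"] cong: if_cong)

lemma matrix_entry: "hdot (axis i 1) (A *v axis j 1) = A $ i $ j"
  by (simp add: hdot_def matrix_vector_mult_def axis_def if_distrib[of "\<lambda>x. x * _"]
      if_distrib[of "\<lambda>x. _ * x"] if_distrib[of cnj] cong: if_cong)

text \<open>
  Polarization: the test vectors \<open>e\<^sub>i + e\<^sub>j\<close> and \<open>e\<^sub>i + \<i> e\<^sub>j\<close> compare the imaginary and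
  the real parts of the two entries.
\<close>

lemma entries_hermitian:
  assumes real: "\<And>u. Im (hdot u (A *v u)) = 0"
  shows "A $ i $ j = cnj (A $ j $ i)"
proof -
  have exp: "hdot (axis i 1 + c *s axis j 1) (A *v (axis i 1 + c *s axis j 1))
     = A $ i $ i + c * A $ i $ j + cnj c * A $ j $ i + cnj c * c * A $ j $ j" for c
    by (simp add: matrix_vector_right_distrib vec_scale_matrix hdot_add_left hdot_add_right
        hdot_scale_left hdot_scale_right matrix_entry algebra_simps)
  have d: "Im (A $ k $ k) = 0" for k
    using real[of "axis k 1"] by (simp add: matrix_entry)
  have "Im (A $ i $ j) + Im (A $ j $ i) = 0"
    using real[of "axis i 1 + 1 *s axis j 1"] unfolding exp by (simp add: d)
  moreover have "Re (A $ i $ j) = Re (A $ j $ i)"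
    using real[of "axis i 1 + \<i> *s axis j 1"] unfolding exp by (simp add: d)
  ultimately show ?thesis by (simp add: complex_eq_iff)
qed

section \<open>Singular value decomposition\<close>

text \<open>
  For a unit vector \<open>u\<close> this is \<open>I + (\<omega> - 1) u u\<^sup>*\<close>, which multiplies \<open>u\<close> by \<open>\<omega>\<close> and fixes its
  orthogonal complement.  These unitary matrices are perturbations fine enough to replace
  the derivative when a trace is maximised over the unitary group.
\<close>

definition complex_reflection :: "complex ^ ('n::finite) \<Rightarrow> complex \<Rightarrow> 'n cmat" where
  "complex_reflection u \<omega> = (\<chi> i j. (if i = j then 1 else 0) + (\<omega> - 1) * (u $ i * cnj (u $ j)))"

lemma complex_reflection_mult_vec: "complex_reflection u \<omega> *v x = x + ((\<omega> - 1) * hdot u x) *s u"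
  by (simp add: complex_reflection_def vec_eq_iff matrix_vector_mult_def hdot_def algebra_simps
      sum.distrib sum_subtractf sum_distrib_left sum_distrib_right if_distrib[of "\<lambda>x. _ * x"] cong: if_cong)

lemma unitary_reflection:
  assumes "hdot u u = 1" "cmod \<omega> = 1"
  shows "unitary (complex_reflection u \<omega>)"
proof -
  have ct: "conj_transpose (complex_reflection u \<omega>) = complex_reflection u (cnj \<omega>)" for \<omega>
    by (simp add: complex_reflection_def conj_transpose_def vec_eq_iff mult_ac)
  have "complex_reflection u \<omega> ** complex_reflection u (cnj \<omega>) = mat 1" if "cmod \<omega> = 1" for \<omega>
  proof -
    have w: "\<omega> * cnj \<omega> = 1" using that by (simp add: complex_norm_square[symmetric])
    have "complex_reflection u \<omega> *v (complex_reflection u (cnj \<omega>) *v x) = x" for x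
    proof -
      have e: "(cnj \<omega> - 1) + (\<omega> - 1) * (1 + (cnj \<omega> - 1)) = 0"
        using w by (simp add: algebra_simps)
      have "complex_reflection u \<omega> *v (complex_reflection u (cnj \<omega>) *v x) =
         x + (((cnj \<omega> - 1) + (\<omega> - 1) * (1 + (cnj \<omega> - 1))) * hdot u x) *s u"
        unfolding complex_reflection_mult_vec hdot_add_right hdot_scale_right assms(1)
        by (simp add: vec_eq_iff algebra_simps)
      then show ?thesis by (simp only: e) simp
    qed
    then show ?thesis by (simp add: matrix_eq matrix_vector_mul_assoc[symmetric])
  qed
  from this[of \<omega>] this[of "cnj \<omega>"] show ?thesis
    using assms(2) by (simp add: unitary_def ct)
qed

lemma trace_reflection_mult:
  "trace (complex_reflection u \<omega> ** A) = trace A + (\<omega> - 1) * hdot u (A *v u)"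
proof -
  have "complex_reflection u \<omega> ** A = A + (\<chi> i j. (\<omega> - 1) * (u $ i * (\<Sum>k\<in>UNIV. cnj (u $ k) * A $ k $ j)))"
    by (simp add: complex_reflection_def vec_eq_iff matrix_matrix_mult_def algebra_simps
      sum.distrib sum_subtractf sum_distrib_left sum_distrib_right if_distrib[of "\<lambda>x. _ * x"] cong: if_cong)
  then have "trace (complex_reflection u \<omega> ** A) = trace A +
     (\<omega> - 1) * (\<Sum>i\<in>UNIV. \<Sum>k\<in>UNIV. cnj (u $ k) * (A $ k $ i * u $ i))"
    by (simp add: trace_def sum.distrib sum_distrib_left mult_ac)
  also have "(\<Sum>i\<in>UNIV. \<Sum>k\<in>UNIV. cnj (u $ k) * (A $ k $ i * u $ i)) = hdot u (A *v u)"
    by (subst sum.swap) (simp add: hdot_def matrix_vector_mult_def sum_distrib_left)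
  finally show ?thesis .
qed

text \<open>
  The rotation by \<open>cnj z / cmod z\<close> carries \<open>z\<close> to \<open>cmod z\<close>, so \<open>cmod z \<le> Re z\<close>.
\<close>

lemma nonneg_if_rotations_decrease_Re:
  assumes "\<And>\<omega>. cmod \<omega> = 1 \<Longrightarrow> Re (\<omega> * z) \<le> Re z"
  shows "Im z = 0" "0 \<le> Re z"
proof -
  have "cmod z \<le> Re z"
  proof (cases "z = 0")
    case False
    have "cnj z / cmod z * z = cmod z"
      using False by (simp add: mult.commute complex_norm_square[symmetric] power2_eq_square)
    moreover have "cmod (cnj z / cmod z) = 1" using False by (simp add: norm_divide)
    ultimately show ?thesis using assms[of "cnj z / cmod z"] by simp
  qed simp
  moreover from this have "0 \<le> Re z" using norm_ge_zero order_trans by blast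
  ultimately have "(cmod z)\<^sup>2 \<le> (Re z)\<^sup>2" by (intro power_mono) auto
  then show "Im z = 0" "0 \<le> Re z" using \<open>0 \<le> Re z\<close> by (simp_all add: cmod_power2)
qed

text \<open>
  A reflection changes the trace by \<open>(\<omega> - 1) u\<^sup>* A u\<close>; if that never increases its real part,
  each \<open>u\<^sup>* A u\<close> is real and nonnegative, so \<open>A\<close> is positive semidefinite.  Only the two
  consequences for the entries are recorded.
\<close>

lemma psd_if_reflections_decrease_trace:
  assumes "\<And>u \<omega>. hdot u u = 1 \<Longrightarrow> cmod \<omega> = 1 \<Longrightarrow> Re (trace (complex_reflection u \<omega> ** A)) \<le> Re (trace A)"
  shows "A $ i $ j = cnj (A $ j $ i)" "0 \<le> Re (A $ i $ i)"
proof -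
  have *: "Im (hdot u (A *v u)) = 0 \<and> 0 \<le> Re (hdot u (A *v u))" if "hdot u u = 1" for u
    using nonneg_if_rotations_decrease_Re[of "hdot u (A *v u)"] assms[OF that]
    unfolding trace_reflection_mult by (auto simp: algebra_simps)
  have "Im (hdot u (A *v u)) = 0" for u
  proof (cases "u = 0")
    case True then show ?thesis by (simp add: hdot_def)
  next
    case False
    let ?v = "(1 / norm u) *\<^sub>R u"
    have "hdot ?v ?v = 1"
      using False by (simp add: hdot_self dot_square_norm power2_eq_square)
    from *[OF this] have "Im (hdot ?v (A *v ?v)) = 0" by blast
    moreover have "hdot u (A *v u) = of_real ((norm u)\<^sup>2) * hdot ?v (A *v ?v)"
      using False by (simp add: matrix_vector_scaleR hdot_scaleR_left hdot_scaleR_right power2_eq_square)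
    ultimately show ?thesis by simp
  qed
  then show "A $ i $ j = cnj (A $ j $ i)" by (rule entries_hermitian)
  have "hdot (axis i 1) (axis i (1::complex)) = 1"
    by (simp add: hdot_self inner_axis_axis)
  from *[OF this] show "0 \<le> Re (A $ i $ i)" by (simp add: matrix_entry)
qed

definition diag :: "('n \<Rightarrow> complex) \<Rightarrow> ('n::finite) cmat" where
  "diag d = (\<chi> i j. if i = j then d i else 0)"

lemma mult_diag: "(A ** diag d) $ i $ j = A $ i $ j * d j"
  by (simp add: diag_def matrix_matrix_mult_def if_distrib cong: if_cong)

lemma diag_mult: "(diag d ** A) $ i $ j = d i * A $ i $ j"
  by (simp add: diag_def matrix_matrix_mult_def if_distrib[of "\<lambda>x. x * _"] cong: if_cong)

lemma conj_transpose_diag: "conj_transpose (diag d) = diag (\<lambda>i. cnj (d i))"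
  by (simp add: diag_def conj_transpose_def vec_eq_iff)

lemma unitary_diag: "(\<And>i. cmod (d i) = 1) \<Longrightarrow> unitary (diag d)"
  by (auto simp: unitary_def vec_eq_iff diag_mult mult_diag conj_transpose_diag)
     (simp_all add: diag_def mat_def complex_norm_square[symmetric] mult.commute[of "cnj _"])

lemma cmod_unitary_entry_le:
  assumes "unitary U"
  shows "cmod (U $ i $ j) \<le> 1"
proof -
  have "(\<Sum>k\<in>UNIV. of_real ((cmod (U $ i $ k))\<^sup>2)) = (1::complex)"
    using arg_cong[OF conjunct1[OF assms[unfolded unitary_def]], of "\<lambda>A. A $ i $ i"]
    by (simp add: matrix_matrix_mult_def conj_transpose_def mat_def complex_norm_square del: of_real_power)
  then have "(\<Sum>k\<in>UNIV. (cmod (U $ i $ k))\<^sup>2) = 1"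
    by (metis of_real_eq_1_iff of_real_sum)
  moreover have "(cmod (U $ i $ j))\<^sup>2 \<le> (\<Sum>k\<in>UNIV. (cmod (U $ i $ k))\<^sup>2)"
    by (rule member_le_sum) auto
  ultimately have "(cmod (U $ i $ j))\<^sup>2 \<le> 1\<^sup>2" by simp
  then show ?thesis by (rule power2_le_imp_le) simp
qed

lemma continuous_on_matrix_mult [continuous_intros]:
  fixes f g :: "'a::topological_space \<Rightarrow> ('n::finite) cmat"
  assumes "continuous_on S f" "continuous_on S g"
  shows "continuous_on S (\<lambda>x. f x ** g x)"
  unfolding matrix_matrix_mult_def by (intro continuous_intros assms)

lemma continuous_on_conj_transpose [continuous_intros]:
  fixes f :: "'a::topological_space \<Rightarrow> ('n::finite) cmat"
  assumes "continuous_on S f"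
  shows "continuous_on S (\<lambda>x. conj_transpose (f x))"
  unfolding conj_transpose_def by (intro continuous_intros assms)

lemma norm_matrix_le_if_entries_le:
  fixes A :: "('n::finite) cmat"
  assumes "\<And>i j. cmod (A $ i $ j) \<le> c"
  shows "norm A \<le> of_nat (CARD('n) * CARD('n)) * c"
proof -
  have "norm A \<le> (\<Sum>i\<in>UNIV. norm (A $ i))" by (simp add: norm_vec_def L2_set_le_sum)
  also have "\<dots> \<le> (\<Sum>i\<in>UNIV. \<Sum>j\<in>UNIV. cmod (A $ i $ j))"
    by (intro sum_mono) (simp add: norm_vec_def L2_set_le_sum)
  also have "\<dots> \<le> (\<Sum>i\<in>(UNIV :: 'n set). \<Sum>j\<in>(UNIV :: 'n set). c)"
    by (rule sum_mono, rule sum_mono, rule assms)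
  finally show ?thesis by simp
qed

lemma compact_unitary: "compact {U :: ('n::finite) cmat. unitary U}"
  unfolding compact_eq_bounded_closed
proof
  have "norm U \<le> of_nat (CARD('n) * CARD('n)) * 1" if "unitary U" for U :: "'n cmat"
    using cmod_unitary_entry_le[OF that] by (rule norm_matrix_le_if_entries_le)
  then show "bounded {U :: 'n cmat. unitary U}" by (auto simp: bounded_iff)
  have "closed {U :: 'n cmat. U ** conj_transpose U = mat 1}"
       "closed {U :: 'n cmat. conj_transpose U ** U = mat 1}"
    by (intro closed_Collect_eq continuous_intros)+
  from closed_Int[OF this] show "closed {U :: 'n cmat. unitary U}"
    by (simp add: unitary_def Collect_conj_eq)
qed

text \<open>
  Fix a diagonal matrix \<open>W\<close> of distinct positive weights and let unitary \<open>U\<close>, \<open>V\<close> maximise the real part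
  of the trace of \<open>W U A V\<close>, which is possible by compactness.  With \<open>B = U A V\<close>, maximality against
  reflections on either side makes both \<open>B W\<close> and \<open>W B\<close> positive semidefinite.  Being Hermitian, they
  satisfy \<open>B W\<^sup>2 = W B\<^sup>* W = W\<^sup>2 B\<close>; since the squared weights are distinct, \<open>B\<close> is diagonal, and its diagonal
  entries are nonnegative.
\<close>

theorem singular_value_decomposition:
  fixes A :: "('n::finite) cmat"
  obtains U V s where "unitary U" "unitary V" "\<And>i. 0 \<le> s i" "U ** A ** V = diag (\<lambda>i. of_real (s i))"
proof -
  obtain e :: "'n \<Rightarrow> nat" where "inj e"
    using finite_imp_inj_to_nat_seg[of "UNIV :: 'n set"] by auto
  define w :: "'n \<Rightarrow> real" where "w i = real (e i + 1)" for i
  have w_pos: "0 < w i" for i by (simp add: w_def)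
  have w_inj: "w i = w j \<Longrightarrow> i = j" for i j using \<open>inj e\<close> by (simp add: w_def inj_eq)
  define W where "W = diag (\<lambda>i. of_real (w i))"
  define f where "f = (\<lambda>(U :: 'n cmat, V :: 'n cmat). Re (trace (W ** (U ** A ** V))))"
  have "\<exists>p \<in> {U. unitary U} \<times> {U. unitary U}. \<forall>q \<in> {U. unitary U} \<times> {U. unitary U}. f q \<le> f p"
  proof (intro continuous_attains_sup compact_Times compact_unitary)
    show "{U :: 'n cmat. unitary U} \<times> {U :: 'n cmat. unitary U} \<noteq> {}"
      using unitary_mat_1 by auto
    show "continuous_on ({U. unitary U} \<times> {U. unitary U}) f"
      unfolding f_def trace_def case_prod_unfold by (intro continuous_intros)
  qed
  then obtain U V where UV: "unitary U" "unitary V"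
    and max: "\<And>U' V'. unitary U' \<Longrightarrow> unitary V' \<Longrightarrow>
        Re (trace (W ** (U' ** A ** V'))) \<le> Re (trace (W ** (U ** A ** V)))"
    by (auto simp: f_def)
  define B where "B = U ** A ** V"
  have left: "Re (trace (complex_reflection u \<omega> ** (B ** W))) \<le> Re (trace (B ** W))"
    if "hdot u u = 1" "cmod \<omega> = 1" for u \<omega>
  proof -
    have "trace (W ** ((complex_reflection u \<omega> ** U) ** A ** V)) = trace (complex_reflection u \<omega> ** (B ** W))"
      by (subst trace_mul_sym) (simp only: B_def matrix_mul_assoc)
    moreover have "trace (W ** (U ** A ** V)) = trace (B ** W)"
      by (subst trace_mul_sym) (simp only: B_def)
    ultimately show ?thesis
      using max[OF unitary_mult[OF unitary_reflection[OF that] UV(1)] UV(2)] by simp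
  qed
  have right: "Re (trace (complex_reflection u \<omega> ** (W ** B))) \<le> Re (trace (W ** B))"
    if "hdot u u = 1" "cmod \<omega> = 1" for u \<omega>
  proof -
    have "trace (W ** (U ** A ** (V ** complex_reflection u \<omega>))) = trace (complex_reflection u \<omega> ** (W ** B))"
      by (subst (2) trace_mul_sym) (simp only: B_def matrix_mul_assoc)
    then show ?thesis
      using max[OF UV(1) unitary_mult[OF UV(2) unitary_reflection[OF that]]] by (simp add: B_def)
  qed
  have BW: "B $ i $ j * of_real (w j) = cnj (B $ j $ i) * of_real (w i)" for i j
    using psd_if_reflections_decrease_trace(1)[OF left, of i j] by (simp add: W_def mult_diag)
  have WB: "of_real (w i) * B $ i $ j = of_real (w j) * cnj (B $ j $ i)" for i j
    using psd_if_reflections_decrease_trace(1)[OF right, of i j] by (simp add: W_def diag_mult)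
  have off: "B $ i $ j = 0" if "i \<noteq> j" for i j
  proof -
    have "of_real ((w j)\<^sup>2) * B $ i $ j = of_real (w i) * (of_real (w j) * cnj (B $ j $ i))"
      using BW[of i j] by (simp add: power2_eq_square mult_ac)
    also have "\<dots> = of_real ((w i)\<^sup>2) * B $ i $ j"
      using WB[of i j] by (simp add: power2_eq_square mult_ac)
    finally have "(w j)\<^sup>2 = (w i)\<^sup>2 \<or> B $ i $ j = 0"
      by (simp only: mult_cancel_right of_real_eq_iff) blast
    then show ?thesis
      using that w_inj[of i j] w_pos[of i] w_pos[of j] power2_eq_imp_eq[of "w j" "w i"] by auto
  qed
  have "B $ i $ i = of_real (Re (B $ i $ i)) \<and> 0 \<le> Re (B $ i $ i)" for i
  proof
    show "B $ i $ i = of_real (Re (B $ i $ i))"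
      using BW[of i i] w_pos[of i] by (simp add: complex_eq_iff)
    show "0 \<le> Re (B $ i $ i)"
      using psd_if_reflections_decrease_trace(2)[OF left, of i] w_pos[of i]
      by (simp add: W_def mult_diag zero_le_mult_iff)
  qed
  then have "B = diag (\<lambda>i. of_real (Re (B $ i $ i)))" "\<And>i. 0 \<le> Re (B $ i $ i)"
    using off unfolding diag_def vec_eq_iff by (auto simp: vec_eq_iff)
  then show ?thesis using that[of U V "\<lambda>i. Re (B $ i $ i)"] UV unfolding B_def by blast
qed

section \<open>Unitarily invariant norms and quadratic forms\<close>

lemma norm_mat_scaleR:
  assumes "unitarily_invariant_norm N"
  shows "N (r *\<^sub>R A) = \<bar>r\<bar> * N A"
proof -
  have "r *\<^sub>R A = mat (of_real r) ** A"
    by (simp add: vec_eq_iff mat_def matrix_matrix_mult_def if_distrib[of "\<lambda>x. x * _"]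
        scaleR_conv_of_real[where 'a = complex] cong: if_cong)
  then show ?thesis
    using assms by (simp add: unitarily_invariant_norm_def is_matrix_norm_def)
qed

lemma norm_triangle:
  assumes "unitarily_invariant_norm N"
  shows "N (A + B) \<le> N A + N B"
  using assms by (simp add: unitarily_invariant_norm_def is_matrix_norm_def)

lemma norm_unitary:
  assumes "unitarily_invariant_norm N" "unitary U" "unitary V"
  shows "N (U ** A ** V) = N A"
  using assms by (metis unitarily_invariant_norm_def)

lemma norm_midpoint_le:
  assumes "unitarily_invariant_norm N" "N A \<le> r" "N B \<le> r"
  shows "N ((1/2) *\<^sub>R (A + B)) \<le> r"
  using norm_mat_scaleR[OF assms(1), of "1/2" "A + B"] norm_triangle[OF assms(1), of A B] assms by simp

text \<open>
  Conjugation by the diagonal matrix with \<open>-1\<close> in place \<open>k\<close> changes the sign of the off-diagonal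
  part of row and column \<open>k\<close>, so averaging \<open>A\<close> with the result deletes that part without
  increasing the norm.  This is done for one index after the other.
\<close>

lemma norm_diagonal_part_le:
  fixes A :: "('n::finite) cmat"
  assumes N: "unitarily_invariant_norm N"
  shows "N (diag (\<lambda>i. A $ i $ i)) \<le> N A"
proof -
  define pinch where "pinch F = (\<chi> i j. if i = j \<or> (i \<notin> F \<and> j \<notin> F) then A $ i $ j else 0)" for F
  have "N (pinch F) \<le> N A" if "finite F" for F
    using that
  proof (induction F)
    case empty
    have "pinch {} = A" by (simp add: pinch_def vec_eq_iff)
    then show ?case by simp
  next
    case (insert k F)
    define S :: "'n cmat" where "S = diag (\<lambda>i. if i = k then -1 else 1)"
    have S: "unitary S" unfolding S_def by (rule unitary_diag) simp
    have "pinch (insert k F) = (1/2) *\<^sub>R (pinch F + S ** pinch F ** S)"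
      by (auto simp: vec_eq_iff S_def mult_diag diag_mult pinch_def scaleR_conv_of_real[where 'a = complex])
    then show ?case
      using norm_midpoint_le[OF N insert.IH] norm_unitary[OF N S S] insert.IH by metis
  qed
  moreover have "pinch UNIV = diag (\<lambda>i. A $ i $ i)"
    by (auto simp: pinch_def diag_def vec_eq_iff)
  ultimately show ?thesis by (metis finite)
qed

lemma unit_disc_midpoint:
  assumes "cmod z \<le> 1"
  obtains a b where "cmod a = 1" "cmod b = 1" "z = (a + b) / 2"
proof
  let ?t = "arccos (cmod z)"
  show "cmod (cis (Arg z + ?t)) = 1" "cmod (cis (Arg z - ?t)) = 1" by simp_all
  have "cis (Arg z + ?t) + cis (Arg z - ?t) = 2 * of_real (cos ?t) * cis (Arg z)"
    by (simp add: complex_eq_iff cos_add cos_diff sin_add sin_diff)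
  also have "cos ?t = cmod z"
    using assms by (intro cos_arccos) (auto intro: order_trans[OF _ norm_ge_zero])
  finally show "z = (cis (Arg z + ?t) + cis (Arg z - ?t)) / 2"
    using rcis_cmod_Arg[of z] by (simp add: rcis_def)
qed

text \<open>
  If \<open>cmod (p i) \<le> cmod (q i)\<close>, then \<open>p i\<close> is the midpoint of two rotations of \<open>q i\<close>, so \<open>diag p\<close> is
  the midpoint of two unitary multiples of \<open>diag q\<close>.
\<close>

lemma norm_diag_mono:
  fixes p q :: "'n::finite \<Rightarrow> complex"
  assumes N: "unitarily_invariant_norm N" and le: "\<And>i. cmod (p i) \<le> cmod (q i)"
  shows "N (diag p) \<le> N (diag q)"
proof -
  have "\<exists>a b. cmod a = 1 \<and> cmod b = 1 \<and> p i / q i = (a + b) / 2" for i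
  proof -
    have "cmod (p i / q i) \<le> 1"
      using le[of i] by (cases "q i = 0") (auto simp: norm_divide divide_le_eq)
    from unit_disc_midpoint[OF this] show ?thesis by metis
  qed
  then obtain a b where ab: "\<And>i. cmod (a i) = 1" "\<And>i. cmod (b i) = 1"
    "\<And>i. p i / q i = (a i + b i) / 2"
    by metis
  have p: "p i = (a i + b i) / 2 * q i" for i
    using le[of i] by (cases "q i = 0") (simp_all flip: ab(3))
  have "diag p = (1/2) *\<^sub>R (diag a ** diag q + diag b ** diag q)"
    by (simp add: vec_eq_iff diag_mult) (simp add: diag_def p scaleR_conv_of_real[where 'a = complex] field_simps)
  moreover have "N (diag a ** diag q) = N (diag q)" "N (diag b ** diag q) = N (diag q)"
    using norm_unitary[OF N unitary_diag unitary_mat_1, of a "diag q"]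
      norm_unitary[OF N unitary_diag unitary_mat_1, of b "diag q"] ab by simp_all
  ultimately show ?thesis
    using norm_midpoint_le[OF N, of "diag a ** diag q" "N (diag q)" "diag b ** diag q"] by simp
qed

text \<open>
  The link between norms and quadratic forms.  A singular value of \<open>A\<close> is \<open>y \<bullet> (A *v x)\<close> for a pair of
  unit singular vectors, so it is at most the corresponding diagonal entry of the average of two
  unitary conjugates of \<open>H\<close>.  Passing from that average to its diagonal part, and from there to the
  smaller diagonal matrix of singular values, does not increase the norm.  It contains the
  monotonicity of \<open>N\<close> on positive semidefinite matrices, as well as a bound of the norm of a sectorial
  matrix by its real part, since \<open>H\<close> enters only through the form of its real part.
\<close>

theorem norm_le_if_form_le:
  fixes A H :: "('n::finite) cmat"
  assumes N: "unitarily_invariant_norm N"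
    and le: "\<And>x y. y \<bullet> (A *v x) \<le> (x \<bullet> (H *v x) + y \<bullet> (H *v y)) / 2"
  shows "N A \<le> N H"
proof -
  obtain U V s where UV: "unitary U" "unitary V" and s: "\<And>i. 0 \<le> s i"
    and svd: "U ** A ** V = diag (\<lambda>i. of_real (s i))"
    using singular_value_decomposition[of A] by metis
  define D where "D = (1/2) *\<^sub>R (conj_transpose V ** H ** V + U ** H ** conj_transpose U)"
  have s_le: "s i \<le> Re (D $ i $ i)" for i
  proof -
    let ?e = "axis i 1 :: complex ^ 'n"
    let ?x = "V *v ?e" and ?y = "conj_transpose U *v ?e"
    have entry: "Re (M $ i $ i) = ?e \<bullet> (M *v ?e)" for M
      by (simp flip: matrix_entry Re_hdot)
    have "s i = ?e \<bullet> ((U ** A ** V) *v ?e)"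
      unfolding svd entry[symmetric] by (simp add: diag_def)
    also have "\<dots> = ?y \<bullet> (A *v ?x)"
      by (simp add: inner_conj_transpose flip: matrix_vector_mul_assoc)
    also have "\<dots> \<le> (?x \<bullet> (H *v ?x) + ?y \<bullet> (H *v ?y)) / 2" by (rule le)
    also have "\<dots> = Re (D $ i $ i)"
      unfolding entry D_def
      by (simp add: inner_conj_transpose scaleR_matrix_vector matrix_vector_mult_add_rdistrib
          inner_add_right flip: matrix_vector_mul_assoc)
    finally show ?thesis .
  qed
  have "N A = N (diag (\<lambda>i. of_real (s i)))"
    using norm_unitary[OF N UV, of A] svd by simp
  also have "\<dots> \<le> N (diag (\<lambda>i. D $ i $ i))"
    using s s_le complex_Re_le_cmod by (intro norm_diag_mono[OF N]) (simp, meson order_trans)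
  also have "\<dots> \<le> N D" by (rule norm_diagonal_part_le[OF N])
  also have "\<dots> \<le> N H"
    unfolding D_def using UV by (intro norm_midpoint_le[OF N]) (simp_all add: norm_unitary[OF N] unitary_conj_transpose)
  finally show ?thesis .
qed

section \<open>Sectorial matrices\<close>

lemma sector_add: "z \<in> sector \<alpha> \<Longrightarrow> w \<in> sector \<alpha> \<Longrightarrow> z + w \<in> sector \<alpha>"
  by (auto simp: sector_def algebra_simps)

lemma sector_scale: "z \<in> sector \<alpha> \<Longrightarrow> 0 < r \<Longrightarrow> of_real r * z \<in> sector \<alpha>"
  by (auto simp: sector_def abs_mult mult.assoc)

lemma sector_cnj: "z \<in> sector \<alpha> \<Longrightarrow> cnj z \<in> sector \<alpha>"
  by (auto simp: sector_def)

text \<open>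
  The numerical range condition in homogeneous form; the sector being a convex cone closed under
  conjugation, it is inherited by sums, positive multiples and inverses.
\<close>

definition sectorial :: "real \<Rightarrow> ('n::finite) cmat \<Rightarrow> bool" where
  "sectorial \<alpha> A \<longleftrightarrow> (\<forall>x. x \<noteq> 0 \<longrightarrow> hdot x (A *v x) \<in> sector \<alpha>)"

lemma sectorial_if_numerical_range:
  assumes "numerical_range A \<subseteq> sector \<alpha>"
  shows "sectorial \<alpha> A"
  unfolding sectorial_def
proof (intro allI impI)
  fix x :: "complex ^ 'a" assume "x \<noteq> 0"
  let ?v = "(1 / norm x) *\<^sub>R x"
  have "hdot ?v ?v = 1"
    using \<open>x \<noteq> 0\<close> by (simp add: hdot_self dot_square_norm power2_eq_square)
  then have "hdot ?v (A *v ?v) \<in> sector \<alpha>"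
    using assms by (auto simp: numerical_range_def)
  then have "of_real ((norm x)\<^sup>2) * hdot ?v (A *v ?v) \<in> sector \<alpha>"
    using \<open>x \<noteq> 0\<close> by (intro sector_scale) auto
  then show "hdot x (A *v x) \<in> sector \<alpha>"
    using \<open>x \<noteq> 0\<close> by (simp add: matrix_vector_scaleR hdot_scaleR_left hdot_scaleR_right power2_eq_square)
qed

lemma sectorial_add: "sectorial \<alpha> A \<Longrightarrow> sectorial \<alpha> B \<Longrightarrow> sectorial \<alpha> (A + B)"
  by (simp add: sectorial_def matrix_vector_mult_add_rdistrib hdot_add_right sector_add)

lemma sectorial_scaleR: "sectorial \<alpha> A \<Longrightarrow> 0 < r \<Longrightarrow> sectorial \<alpha> (r *\<^sub>R A)"
  by (simp add: sectorial_def scaleR_matrix_vector hdot_scaleR_right sector_scale)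

lemma sectorial_pos: "sectorial \<alpha> A \<Longrightarrow> x \<noteq> 0 \<Longrightarrow> 0 < x \<bullet> (A *v x)"
  by (auto simp: sectorial_def sector_def simp flip: Re_hdot)

lemma sectorial_inv:
  assumes "sectorial \<alpha> A"
  shows "A ** matrix_inv A = mat 1" "matrix_inv A ** A = mat 1"
    "A *v (matrix_inv A *v x) = x" "matrix_inv A *v (A *v x) = x"
    "sectorial \<alpha> (matrix_inv A)"
proof -
  have "x = 0" if "A *v x = 0" for x
    using sectorial_pos[OF assms, of x] that by auto
  then obtain B where "B ** A = mat 1" using matrix_left_invertible_ker[of A] by blast
  then have "\<exists>B. A ** B = mat 1 \<and> B ** A = mat 1"
    using matrix_left_right_inverse by blast
  from someI_ex[OF this]
  show inv: "A ** matrix_inv A = mat 1" "matrix_inv A ** A = mat 1"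
    by (simp_all add: matrix_inv_def)
  then show vec: "A *v (matrix_inv A *v x) = x" "matrix_inv A *v (A *v x) = x" for x
    by (simp_all add: matrix_vector_mul_assoc)
  show "sectorial \<alpha> (matrix_inv A)"
    unfolding sectorial_def
  proof (intro allI impI)
    fix x :: "complex ^ 'a" assume "x \<noteq> 0"
    define y where "y = matrix_inv A *v x"
    have x: "x = A *v y" by (simp add: y_def vec)
    then have "hdot y (A *v y) \<in> sector \<alpha>"
      using \<open>x \<noteq> 0\<close> assms by (cases "y = 0") (auto simp: sectorial_def)
    from sector_cnj[OF this] show "hdot x (matrix_inv A *v x) \<in> sector \<alpha>"
      by (simp add: cnj_hdot x vec)
  qed
qed

text \<open>
  With \<open>f x y = x\<^sup>* A y\<close>, the sector condition says that
  \<open>\<i> cis (- \<alpha>) f w w\<close> and \<open>- \<i> cis \<alpha> f w w\<close> have nonnegative real part.  Take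
  \<open>w = x - cis \<alpha> y\<close> in the first and \<open>w = x - cis (- \<alpha>) y\<close> in the second and add: the phases are
  chosen such that the terms in \<open>f x y\<close> cancel, and
  \<open>2 sin \<alpha> (Re (f x x) + Re (f y y)) \<ge> 2 sin (2 \<alpha>) Re (f y x)\<close> remains.  For \<open>\<alpha> = 0\<close> this is void, but
  then \<open>f\<close> is Hermitian and \<open>w = x - y\<close> does it.
\<close>

lemma sectorial_form_le:
  assumes A: "sectorial \<alpha> A" and \<alpha>: "0 \<le> \<alpha>" "\<alpha> < pi / 2"
  shows "y \<bullet> (A *v x) \<le> (x \<bullet> (A *v x) + y \<bullet> (A *v y)) / (2 * cos \<alpha>)"
proof -
  define f where "f u w = hdot u (A *v w)" for u w
  have expand: "f (x - a *s y) (x - a *s y) = f x x - a * f x y - cnj a * f y x + cnj a * a * f y y" for a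
    by (simp add: f_def matrix_vector_mult_diff_distrib vec_scale_matrix hdot_diff_left hdot_diff_right
        hdot_scale_left hdot_scale_right algebra_simps)
  have cos: "0 < cos \<alpha>" using \<alpha> by (intro cos_gt_zero_pi) auto
  have sect: "0 \<le> Re (f w w) \<and> \<bar>Im (f w w)\<bar> * cos \<alpha> \<le> Re (f w w) * sin \<alpha>" for w
  proof (cases "w = 0")
    case False
    then have "f w w \<in> sector \<alpha>" using A by (simp add: sectorial_def f_def)
    then show "0 \<le> Re (f w w) \<and> \<bar>Im (f w w)\<bar> * cos \<alpha> \<le> Re (f w w) * sin \<alpha>"
      using cos by (auto simp: sector_def tan_def field_simps)
  qed (auto simp: f_def hdot_def)
  have "2 * cos \<alpha> * Re (f y x) \<le> Re (f x x) + Re (f y y)"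
  proof (cases "\<alpha> = 0")
    case True
    then have im: "Im (f w w) = 0" for w using sect[of w] by simp
    have "Re (f x y) = Re (f y x)"
      using im[of "x - \<i> *s y"] im[of x] im[of y] unfolding expand by simp
    then show ?thesis using sect[of "x - 1 *s y"] True unfolding expand by simp
  next
    case False
    then have sin: "0 < sin \<alpha>" using \<alpha> by (simp add: sin_gt_zero2)
    have cc: "cnj (cis t) * cis t = 1" "cis t * cnj (cis t) = 1" for t
      by (simp_all add: complex_eq_iff flip: power2_eq_square)
    have 1: "0 \<le> Re (\<i> * cis (- \<alpha>) * f w w)" "0 \<le> Re (- \<i> * cis \<alpha> * f w w)" for w
    proof -
      have "\<bar>Im (f w w) * cos \<alpha>\<bar> \<le> Re (f w w) * sin \<alpha>"
        using sect[of w] cos by (simp add: abs_mult)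
      then show "0 \<le> Re (\<i> * cis (- \<alpha>) * f w w)" "0 \<le> Re (- \<i> * cis \<alpha> * f w w)"
        by (auto simp: abs_le_iff algebra_simps)
    qed
    have "0 \<le> Re (\<i> * cis (- \<alpha>) * f (x - cis \<alpha> *s y) (x - cis \<alpha> *s y)
               + - \<i> * cis \<alpha> * f (x - cis (- \<alpha>) *s y) (x - cis (- \<alpha>) *s y))"
      unfolding plus_complex.sel by (intro add_nonneg_nonneg 1)
    also have "\<dots> = 2 * sin \<alpha> * (Re (f x x) + Re (f y y)) - 2 * (2 * sin \<alpha> * cos \<alpha>) * Re (f y x)"
      unfolding expand cc by (simp add: algebra_simps power2_eq_square)
    finally have "0 \<le> 2 * sin \<alpha> * (Re (f x x) + Re (f y y) - 2 * cos \<alpha> * Re (f y x))"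
      by (simp add: algebra_simps)
    then show ?thesis using sin by (simp add: zero_le_mult_iff)
  qed
  then show ?thesis
    using cos by (simp add: f_def Re_hdot field_simps)
qed

section \<open>Inequalities of Kantorovich type\<close>

text \<open>
  The operator inequality \<open>G\<^sup>2 \<le> c G\<close> for \<open>0 \<le> G \<le> c I\<close>, from the nonnegativity of the form of \<open>G\<close>
  at \<open>u - t G u\<close>.  For \<open>0 < c\<close> the best choice is \<open>t = 1 / c\<close>; for \<open>c = 0\<close> the form vanishes and
  \<open>t = 1\<close> serves.
\<close>

lemma norm_sq_le_scaled_form:
  fixes G :: "'a::real_inner \<Rightarrow> 'a"
  assumes lin: "linear G" and adj: "\<And>x y. G x \<bullet> y = x \<bullet> G y"
    and pos: "\<And>x. 0 \<le> x \<bullet> G x" and le: "\<And>x. x \<bullet> G x \<le> c * (x \<bullet> x)"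
  shows "G u \<bullet> G u \<le> c * (u \<bullet> G u)"
proof -
  have expand: "(u - t *\<^sub>R G u) \<bullet> G (u - t *\<^sub>R G u) = u \<bullet> G u - 2 * t * (G u \<bullet> G u) + t\<^sup>2 * (G u \<bullet> G (G u))" for t
    by (simp add: linear_diff[OF lin] linear_scale[OF lin] inner_diff_left inner_diff_right
        adj[of u "G u", symmetric] power2_eq_square algebra_simps)
  have ineq: "2 * t * (G u \<bullet> G u) \<le> u \<bullet> G u + t\<^sup>2 * (c * (G u \<bullet> G u))" for t
    using pos[of "u - t *\<^sub>R G u"] mult_left_mono[OF le[of "G u"], of "t\<^sup>2"] unfolding expand by simp
  consider "u = 0" | "c = 0" | "u \<noteq> 0" "0 < c"
  proof -
    have "0 < u \<bullet> u \<Longrightarrow> 0 \<le> c"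
      using order_trans[OF pos[of u] le[of u]] zero_le_mult_iff[of c "u \<bullet> u"] by linarith
    then show thesis using that by (cases "u = 0") (auto simp: less_le)
  qed
  then show ?thesis
  proof cases
    case 1 then show ?thesis by (simp add: linear_0[OF lin])
  next
    case 2 then show ?thesis using ineq[of 1] le[of u] by simp
  next
    case 3 then show ?thesis using ineq[of "1 / c"] by (simp add: field_simps power2_eq_square)
  qed
qed

text \<open>
  Two facts in one: \<open>2 z \<bullet> w - z \<bullet> P z \<le> w \<bullet> P\<inverse> w\<close> (expand the form of \<open>P\<close> at \<open>z - P\<inverse> w\<close>), and
  \<open>P\<inverse> \<le> ((M + m) I - P) / (M m)\<close>, which is \<open>(P - m I) (M I - P) \<ge> 0\<close> divided by \<open>M m P\<close>.  The right-hand
  side is affine in \<open>P\<close>, and thus inequalities for several operators can be added and integrated.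
\<close>

lemma kantorovich_tangent:
  fixes P :: "'a::euclidean_space \<Rightarrow> 'a"
  assumes lin: "linear P" and adj: "\<And>x y. P x \<bullet> y = x \<bullet> P y"
    and m: "0 < m" "\<And>x. m * (x \<bullet> x) \<le> x \<bullet> P x" and M: "\<And>x. x \<bullet> P x \<le> M * (x \<bullet> x)" "m \<le> M"
  shows "2 * (z \<bullet> w) - z \<bullet> P z \<le> ((M + m) * (w \<bullet> w) - w \<bullet> P w) / (M * m)"
proof -
  have "x = 0" if "P x = 0" for x
    using m(2)[of x] m(1) that inner_ge_zero[of x] by (simp add: mult_le_0_iff)
  then have "inj P" using linear_injective_0[OF lin] by blast
  then obtain u where w: "w = P u"
    using linear_injective_imp_surjective[OF lin] by (metis surj_def)
  \<comment> \<open>With \<open>G = P - m\<close>, the polynomial \<open>P (P - m) (M - P)\<close> is \<open>m ((M - m) G - G\<^sup>2) + G (M - P) G\<close>, a sum of two nonnegative terms.\<close>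
  define G where "G x = P x - m *\<^sub>R x" for x
  define g where "g = G u"
  have P: "P u = g + m *\<^sub>R u" by (simp add: g_def G_def)
  have "g \<bullet> g \<le> (M - m) * (u \<bullet> g)"
    unfolding g_def
  proof (rule norm_sq_le_scaled_form)
    show "linear G" unfolding G_def using lin
      by (intro linear_compose_sub linear_scale_self)
  qed (use adj m M in \<open>auto simp: G_def inner_diff_left inner_diff_right algebra_simps\<close>)
  then have 1: "0 \<le> m * ((M - m) * (u \<bullet> g) - g \<bullet> g)" using m(1) by simp
  have 2: "0 \<le> M * (g \<bullet> g) - g \<bullet> P g" using M by simp
  have adj': "u \<bullet> P g = g \<bullet> g + m * (u \<bullet> g)"
    using adj[of u g] by (simp add: P inner_add_left)
  have "(M + m) * (w \<bullet> w) - w \<bullet> P w - (M * m) * (u \<bullet> P u)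
      = m * ((M - m) * (u \<bullet> g) - g \<bullet> g) + (M * (g \<bullet> g) - g \<bullet> P g)"
    unfolding w by (simp add: P linear_add[OF lin] linear_scale[OF lin] inner_add_left inner_add_right
        adj' inner_commute[of g u] algebra_simps)
  then have "u \<bullet> P u \<le> ((M + m) * (w \<bullet> w) - w \<bullet> P w) / (M * m)"
    using 1 2 m(1) M(2) by (simp add: le_divide_eq mult_ac)
  moreover have "0 \<le> (z - u) \<bullet> P (z - u)"
    using m(2)[of "z - u"] m(1) by (meson inner_ge_zero less_imp_le mult_nonneg_nonneg order_trans)
  then have "2 * (z \<bullet> w) - z \<bullet> P z \<le> u \<bullet> P u"
    using adj[of u z] by (simp add: w linear_diff[OF lin] inner_diff_left inner_diff_right inner_commute)
  ultimately show ?thesis by simp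
qed

text \<open>
  The form of \<open>W\<close> at \<open>c x - W x\<close>, that is, the operator \<open>(c - W) W (c - W)\<close>, is nonnegative.
\<close>

lemma kantorovich_square:
  fixes W :: "'a::real_inner \<Rightarrow> 'a"
  assumes lin: "linear W" and adj: "\<And>x y. W x \<bullet> y = x \<bullet> W y" and pos: "\<And>x. 0 \<le> x \<bullet> W x"
  shows "2 * c * (W x \<bullet> W x) - W x \<bullet> W (W x) \<le> c\<^sup>2 * (x \<bullet> W x)"
  using pos[of "c *\<^sub>R x - W x"] adj[of x "W x"]
  by (simp add: linear_diff[OF lin] linear_scale[OF lin] inner_diff_left inner_diff_right
      algebra_simps power2_eq_square inner_commute)

section \<open>The weights of the geometric mean\<close>

text \<open>
  The substitution \<open>s = t / (1 - t)\<close> carries Euler's beta integral over the unit interval to the half line.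
\<close>

lemma beta_integral_half_line:
  fixes p q :: real
  assumes "0 < p" "0 < q"
  defines "f \<equiv> \<lambda>s::real. s powr (p - 1) * (1 + s) powr (- (p + q))"
  shows "set_integrable lborel {0<..} f" "(LBINT s:{0<..}. f s) = Beta p q"
proof -
  define g :: "real \<Rightarrow> real" where "g t = t / (1 - t)" for t
  define h :: "real \<Rightarrow> real" where "h t = t powr (p - 1) * (1 - t) powr (q - 1)" for t
  have img: "g ` {0<..<1} = {0<..}"
  proof
    show "{0<..} \<subseteq> g ` {0<..<1}"
    proof
      fix s :: real assume "s \<in> {0<..}"
      then show "s \<in> g ` {0<..<1}"
        by (intro image_eqI[of _ _ "s / (1 + s)"]) (auto simp: g_def field_simps)
    qed
  qed (auto simp: g_def)
  have der: "(g has_field_derivative 1 / (1 - t)\<^sup>2) (at t within {0<..<1})" if "t \<in> {0<..<1}" for t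
    using that unfolding g_def
    by (auto intro!: derivative_eq_intros simp: power2_eq_square field_simps)
  have inj: "inj_on g {0<..<1}"
    by (auto simp: inj_on_def g_def field_simps)
  have eq: "\<bar>1 / (1 - t)\<^sup>2\<bar> * f (g t) = h t" if "t \<in> {0<..<1}" for t
  proof -
    have "1 + g t = inverse (1 - t)" using that by (simp add: g_def field_simps)
    then have "f (g t) = t powr (p - 1) * (1 - t) powr (1 - p) * (1 - t) powr (p + q)"
      using that by (simp add: f_def) (simp add: g_def powr_divide powr_minus_divide powr_diff powr_add inverse_eq_divide field_simps)
    moreover have "1 / (1 - t)\<^sup>2 = (1 - t) powr (-2)"
      using that by (simp add: powr_minus_divide powr_numeral)
    ultimately show ?thesis
      using that by (simp add: h_def mult.assoc flip: powr_add)

  qed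
  have "set_integrable lborel {0..1} h"
    unfolding h_def using integrable_Beta[OF assms(1,2)] .
  then have "set_integrable lborel {0<..<1} h"
    by (rule set_integrable_subset) auto
  moreover have "(\<lambda>t. indicator {0<..<1} t *\<^sub>R h t) \<in> borel_measurable lborel"
    unfolding h_def by measurable
  ultimately have hI: "h absolutely_integrable_on {0<..<1}"
    unfolding set_integrable_def by (subst integrable_completion)
  have "(h has_integral Beta p q) {0<..<1}"
    using has_integral_Beta_real[OF assms(1,2)] unfolding h_def by (simp add: has_integral_Icc_iff_Ioo)
  then have "integral {0<..<1} h = Beta p q" by (rule integral_unique)
  with hI have "(\<lambda>t. \<bar>1 / (1 - t)\<^sup>2\<bar> * f (g t)) absolutely_integrable_on {0<..<1} \<and>
    integral {0<..<1} (\<lambda>t. \<bar>1 / (1 - t)\<^sup>2\<bar> * f (g t)) = Beta p q"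
    using eq set_integrable_cong[OF refl refl, of "{0<..<1}" "\<lambda>t. \<bar>1 / (1 - t)\<^sup>2\<bar> * f (g t)" h lebesgue]
      integral_cong[of "{0<..<1}" "\<lambda>t. \<bar>1 / (1 - t)\<^sup>2\<bar> * f (g t)" h] by simp
  then have f: "f absolutely_integrable_on {0<..}" "integral {0<..} f = Beta p q"
    using has_absolute_integral_change_of_variables_1'[OF _ der inj, of f "Beta p q"] img by simp_all
  have meas: "(\<lambda>s. indicator {0<..} s *\<^sub>R f s) \<in> borel_measurable lborel"
    unfolding f_def by measurable
  show 1: "set_integrable lborel {0<..} f"
    using f(1) integrable_completion[OF meas] by (simp add: set_integrable_def)
  show "(LBINT s:{0<..}. f s) = Beta p q"
    using f(2) set_borel_integral_eq_integral(2)[OF 1] by simp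
qed

lemma Gamma_reflection_real: "Gamma v * Gamma (1 - v) = pi / sin (v * pi)" for v :: real
proof -
  have "of_real (Gamma v * Gamma (1 - v)) = (of_real (pi / sin (v * pi)) :: complex)"
    using Gamma_reflection_complex[of "of_real v"]
    by (simp add: Gamma_complex_of_real[symmetric] sin_of_real[symmetric] mult.commute)
  then show ?thesis by (simp only: of_real_eq_iff)
qed

text \<open>
  Against the density of the geometric mean, \<open>1 / (1 + s)\<^sup>2\<close> and \<open>s / (1 + s)\<^sup>2\<close> have
  integrals \<open>1 - v\<close> and \<open>v\<close>, the weights of the arithmetic mean: they are the beta integrals
  \<open>Beta v (2 - v)\<close> and \<open>Beta (v + 1) (1 - v)\<close>, evaluated by the reflection formula.
\<close>

lemma geometric_mean_weights:
  fixes v a b :: real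
  assumes v: "0 < v" "v < 1"
  defines "f \<equiv> \<lambda>s. s powr (v - 1) * ((a + s * b) / (1 + s)\<^sup>2)"
  shows "set_integrable lborel {0<..} f"
    "sin (v * pi) / pi * (LBINT s:{0<..}. f s) = (1 - v) * a + v * b"
proof -
  define f1 f2 where "f1 s = s powr (v - 1) * (1 + s) powr (- (v + (2 - v)))"
    and "f2 s = s powr (v + 1 - 1) * (1 + s) powr (- (v + 1 + (1 - v)))" for s :: real
  have I1: "set_integrable lborel {0<..} f1" "(LBINT s:{0<..}. f1 s) = Beta v (2 - v)"
    unfolding f1_def using beta_integral_half_line[of v "2 - v"] v by auto
  have I2: "set_integrable lborel {0<..} f2" "(LBINT s:{0<..}. f2 s) = Beta (v + 1) (1 - v)"
    unfolding f2_def using beta_integral_half_line[of "v + 1" "1 - v"] v by auto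
  have sin: "0 < sin (v * pi)" using v by (intro sin_gt_zero) auto
  have nn: "v \<notin> \<int>\<^sub>\<le>\<^sub>0" "1 - v \<notin> \<int>\<^sub>\<le>\<^sub>0" using v by (auto elim!: nonpos_Ints_cases)
  have B1: "Beta v (2 - v) = (1 - v) * (pi / sin (v * pi))"
    using Gamma_plus1[OF nn(2)] by (simp add: Beta_def Gamma_numeral flip: Gamma_reflection_real)
  have B2: "Beta (v + 1) (1 - v) = v * (pi / sin (v * pi))"
    using Gamma_plus1[OF nn(1)] by (simp add: Beta_def Gamma_numeral flip: Gamma_reflection_real)
  have f: "f s = a * f1 s + b * f2 s" if "s \<in> {0<..}" for s
  proof -
    have "(1 + s) powr (-2) = 1 / (1 + s)\<^sup>2"
      using that by (simp add: powr_minus_divide powr_numeral)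
    moreover have "s powr v = s powr (v - 1) * s"
      using that by (simp add: powr_diff)
    ultimately show ?thesis by (simp add: f_def f1_def f2_def add_divide_distrib algebra_simps)
  qed
  have "set_integrable lborel {0<..} (\<lambda>s. a * f1 s + b * f2 s)"
    using I1(1) I2(1) by (intro set_integral_add set_integrable_mult_right)
  moreover have "set_integrable lborel {0<..} f \<longleftrightarrow> set_integrable lborel {0<..} (\<lambda>s. a * f1 s + b * f2 s)"
    by (intro set_integrable_cong refl f)
  ultimately show "set_integrable lborel {0<..} f" by simp
  have "(LBINT s:{0<..}. f s) = (LBINT s:{0<..}. a * f1 s + b * f2 s)"
    using f by (intro set_lebesgue_integral_cong) auto
  also have "\<dots> = a * Beta v (2 - v) + b * Beta (v + 1) (1 - v)"
    using I1 I2 by (simp add: set_integral_add)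
  finally show "sin (v * pi) / pi * (LBINT s:{0<..}. f s) = (1 - v) * a + v * b"
    unfolding B1 B2 using sin by (simp add: field_simps)
qed

section \<open>The geometric mean as an integral of inverses\<close>

lemma continuous_on_form: "continuous_on S (\<lambda>x. x \<bullet> (A *v x))" for A :: "('n::finite) cmat"
  by (intro continuous_intros linear_continuous_on linear_conv_bounded_linear[THEN iffD1] matrix_vector_mul_linear)

lemma norm_axis_one: "norm (axis i (1 :: complex)) = 1"
  by (simp add: norm_eq_1 inner_axis_axis)

lemma sectorial_lower_bound:
  fixes A :: "('n::finite) cmat"
  assumes "sectorial \<alpha> A"
  obtains \<delta> where "0 < \<delta>" "\<And>x. \<delta> * (x \<bullet> x) \<le> x \<bullet> (A *v x)"
proof -
  have "axis undefined 1 \<in> sphere (0 :: complex ^ 'n) 1" by (simp add: norm_axis_one)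
  then have "\<exists>x \<in> sphere (0 :: complex ^ 'n) 1. \<forall>y \<in> sphere 0 1. x \<bullet> (A *v x) \<le> y \<bullet> (A *v y)"
    by (intro continuous_attains_inf continuous_on_form) auto
  then obtain x0 where x0: "norm x0 = 1" "\<And>y. norm y = 1 \<Longrightarrow> x0 \<bullet> (A *v x0) \<le> y \<bullet> (A *v y)" by auto
  show thesis
  proof
    show "0 < x0 \<bullet> (A *v x0)" using x0(1) by (intro sectorial_pos[OF assms]) auto
    show "x0 \<bullet> (A *v x0) * (x \<bullet> x) \<le> x \<bullet> (A *v x)" for x
    proof (cases "x = 0")
      case False
      define y where "y = (1 / norm x) *\<^sub>R x"
      have "x \<bullet> (A *v x) = (y \<bullet> (A *v y)) * (x \<bullet> x)"
        using False by (simp add: y_def matrix_vector_scaleR dot_square_norm power2_eq_square)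
      moreover have "x0 \<bullet> (A *v x0) \<le> y \<bullet> (A *v y)"
        using False by (intro x0(2)) (simp add: y_def)
      ultimately show ?thesis by (simp add: mult_right_mono)
    qed simp
  qed
qed

text \<open>
  If the real parts of \<open>X\<close> and \<open>Y\<close> are at least \<open>d I\<close>, that of \<open>X + s Y\<close> is at least
  \<open>d (1 + s) I\<close>, which bounds the inverse.
\<close>

lemma resolvent_bound:
  assumes X: "sectorial \<alpha> X" and Y: "sectorial \<alpha> Y"
  obtains C where "0 < C" "\<And>s x. 0 < s \<Longrightarrow> norm (matrix_inv (X + s *\<^sub>R Y) *v x) \<le> C / (1 + s) * norm x"
proof -
  obtain a b where a: "0 < a" "\<And>x. a * (x \<bullet> x) \<le> x \<bullet> (X *v x)"
    and b: "0 < b" "\<And>x. b * (x \<bullet> x) \<le> x \<bullet> (Y *v x)"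
    using sectorial_lower_bound[OF X] sectorial_lower_bound[OF Y] by metis
  define d where "d = min a b"
  have d: "0 < d" "d * (x \<bullet> x) \<le> x \<bullet> (X *v x)" "d * (x \<bullet> x) \<le> x \<bullet> (Y *v x)" for x
    using a b order_trans[OF mult_right_mono[of d a "x \<bullet> x"] a(2)[of x]]
      order_trans[OF mult_right_mono[of d b "x \<bullet> x"] b(2)[of x]] by (auto simp: d_def)
  show thesis
  proof
    show "0 < 1 / d" using d(1) by simp
    fix s :: real and x assume s: "0 < s"
    define z where "z = matrix_inv (X + s *\<^sub>R Y) *v x"
    have "(X + s *\<^sub>R Y) *v z = x"
      unfolding z_def by (rule sectorial_inv(3)[OF sectorial_add[OF X sectorial_scaleR[OF Y s]]])
    then have "z \<bullet> x = z \<bullet> (X *v z) + s * (z \<bullet> (Y *v z))"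
      by (metis inner_add_right inner_scaleR_right matrix_vector_mult_add_rdistrib scaleR_matrix_vector)
    moreover have "s * (d * (z \<bullet> z)) \<le> s * (z \<bullet> (Y *v z))"
      using s d(3) by (intro mult_left_mono) auto
    ultimately have "d * (1 + s) * (z \<bullet> z) \<le> z \<bullet> x"
      using d(2)[of z] by (simp add: algebra_simps)
    also have "\<dots> \<le> norm z * norm x" by (rule norm_cauchy_schwarz)
    finally have "norm z * (d * (1 + s) * norm z) \<le> norm z * norm x"
      by (simp add: dot_square_norm power2_eq_square mult_ac)
    then have "z = 0 \<or> d * (1 + s) * norm z \<le> norm x"
      by (cases "z = 0") auto
    moreover have "0 < d * (1 + s)" using d(1) s by simp
    ultimately have "norm z \<le> norm x / (d * (1 + s))" by (auto simp: pos_le_divide_eq mult.commute)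
    then show "norm z \<le> 1 / d / (1 + s) * norm x" by simp
  qed
qed

text \<open>
  By the resolvent identity, two inverses differ by \<open>(t - s)\<close> times a bounded factor.
\<close>

lemma continuous_on_resolvent:
  fixes X Y :: "('n::finite) cmat"
  assumes X: "sectorial \<alpha> X" and Y: "sectorial \<alpha> Y"
  shows "continuous_on {0<..} (\<lambda>s. matrix_inv (X + s *\<^sub>R Y))"
proof -
  define Z where "Z s = matrix_inv (X + s *\<^sub>R Y)" for s
  obtain C where C: "0 < C" "\<And>s x. 0 < s \<Longrightarrow> norm (Z s *v x) \<le> C / (1 + s) * norm x"
    using resolvent_bound[OF X Y] unfolding Z_def by metis
  have inv: "(X + s *\<^sub>R Y) *v (Z s *v x) = x" "Z s *v ((X + s *\<^sub>R Y) *v x) = x" if "0 < s" for s x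
    unfolding Z_def using sectorial_inv[OF sectorial_add[OF X sectorial_scaleR[OF Y that]]] by auto
  have vec: "continuous_on {0<..} (\<lambda>s. Z s *v x)" for x
    unfolding continuous_on_def
  proof
    fix t :: real assume "t \<in> {0<..}"
    then have t: "0 < t" by simp
    define w where "w = Y *v (Z t *v x)"
    have "norm (Z s *v x - Z t *v x) \<le> \<bar>t - s\<bar> * (C * norm w)" if s: "0 < s" for s
    proof -
      have "(X + s *\<^sub>R Y) *v (Z t *v x) = (X + t *\<^sub>R Y) *v (Z t *v x) + (s - t) *\<^sub>R w"
        by (simp add: w_def matrix_vector_mult_add_rdistrib scaleR_matrix_vector algebra_simps)
      then have "Z t *v x = Z s *v x + (s - t) *\<^sub>R (Z s *v w)"
        by (metis inv(1)[OF t] inv(2)[OF s] matrix_vector_right_distrib matrix_vector_scaleR)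
      then have "norm (Z s *v x - Z t *v x) = \<bar>t - s\<bar> * norm (Z s *v w)"
        by (metis abs_minus_commute add_diff_cancel_left' norm_minus_commute norm_scaleR)
      moreover have "C / (1 + s) * norm w \<le> C * norm w"
        using C(1) s by (intro mult_right_mono) (auto simp: field_simps)
      ultimately show ?thesis
        using C(2)[OF s, of w] by (simp add: mult_left_mono)
    qed
    then have "eventually (\<lambda>s. norm (Z s *v x - Z t *v x) \<le> \<bar>t - s\<bar> * (C * norm w)) (at t within {0<..})"
      by (auto simp: eventually_at_filter)
    moreover have "((\<lambda>s. \<bar>t - s\<bar> * (C * norm w)) \<longlongrightarrow> 0) (at t within {0<..})"
      by (auto intro!: tendsto_eq_intros)
    ultimately have "((\<lambda>s. Z s *v x - Z t *v x) \<longlongrightarrow> 0) (at t within {0<..})"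
      by (rule Lim_null_comparison)
    then show "((\<lambda>s. Z s *v x) \<longlongrightarrow> Z t *v x) (at t within {0<..})"
      by (rule LIM_zero_cancel)
  qed
  have entry: "M = (\<chi> i j. (M *v axis j 1) $ i)" for M :: "'n cmat"
    by (simp add: vec_eq_iff mult_axis_component)
  have "continuous_on {0<..} (\<lambda>s. \<chi> i j. (Z s *v axis j 1) $ i)"
    by (intro continuous_intros vec)
  then show ?thesis by (simp flip: entry Z_def)
qed

lemma set_integrable_resolvent:
  fixes X Y :: "('n::finite) cmat"
  assumes X: "sectorial \<alpha> X" and Y: "sectorial \<alpha> Y" and v: "0 < v" "v < 1"
  shows "set_integrable lborel {0<..} (\<lambda>s. s powr (v - 1) *\<^sub>R matrix_inv (X + s *\<^sub>R Y))"
proof -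
  obtain C where C: "\<And>s x. 0 < s \<Longrightarrow> norm (matrix_inv (X + s *\<^sub>R Y) *v x) \<le> C / (1 + s) * norm x"
    using resolvent_bound[OF X Y] by metis
  define c where "c = of_nat (CARD('n) * CARD('n)) * C"
  show ?thesis
  proof (rule set_integrable_bound)
    show "set_integrable lborel {0<..} (\<lambda>s. s powr (v - 1) * ((c + s * c) / (1 + s)\<^sup>2))"
      by (rule geometric_mean_weights(1)[OF v])
    have "continuous_on {0<..} (\<lambda>s. s powr (v - 1) *\<^sub>R matrix_inv (X + s *\<^sub>R Y))"
      by (intro continuous_intros continuous_on_resolvent[OF X Y]) auto
    from borel_measurable_continuous_on_indicator[OF _ this]
    show "set_borel_measurable lborel {0<..} (\<lambda>s. s powr (v - 1) *\<^sub>R matrix_inv (X + s *\<^sub>R Y))"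
      by (simp add: set_borel_measurable_def)
    have "norm (s powr (v - 1) *\<^sub>R matrix_inv (X + s *\<^sub>R Y))
        \<le> norm (s powr (v - 1) * ((c + s * c) / (1 + s)\<^sup>2))" if s: "0 < s" for s
    proof -
      have "norm (matrix_inv (X + s *\<^sub>R Y)) \<le> c / (1 + s)"
      proof -
        have "cmod (matrix_inv (X + s *\<^sub>R Y) $ i $ j) \<le> C / (1 + s)" for i j
          using Finite_Cartesian_Product.norm_nth_le[of "matrix_inv (X + s *\<^sub>R Y) *v axis j 1" i]
            C[OF s, of "axis j 1"] by (simp add: mult_axis_component norm_axis_one)
        from norm_matrix_le_if_entries_le[OF this] show ?thesis by (simp add: c_def)
      qed
      also have "c / (1 + s) = (c + s * c) / (1 + s)\<^sup>2"
      proof -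
        have "c + s * c = c * (1 + s)" by (simp add: algebra_simps)
        then show ?thesis using s by (simp add: power2_eq_square)
      qed
      also have "\<dots> \<le> \<bar>(c + s * c) / (1 + s)\<^sup>2\<bar>" by (rule abs_ge_self)
      finally show ?thesis
        unfolding norm_scaleR real_norm_def abs_mult by (rule mult_left_mono) simp
    qed
    then show "AE s in lborel. s \<in> {0<..} \<longrightarrow> norm (s powr (v - 1) *\<^sub>R matrix_inv (X + s *\<^sub>R Y))
        \<le> norm (s powr (v - 1) * ((c + s * c) / (1 + s)\<^sup>2))"
      by (intro AE_I2) auto
  qed
qed

text \<open>
  Every inequality about the geometric mean is reduced to the inverses under the integral: a linear
  functional commutes with the integral, and an upper bound of the form \<open>(a + s b) / (1 + s)\<^sup>2\<close> integrates to
  the arithmetic mean of \<open>a\<close> and \<open>b\<close>.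
\<close>

lemma functional_geom_mean_le:
  fixes A B :: "('n::finite) cmat" and \<phi> :: "'n cmat \<Rightarrow> real"
  assumes A: "sectorial \<alpha> A" and B: "sectorial \<alpha> B" and v: "0 < v" "v < 1"
    and \<phi>: "linear \<phi>"
    and le: "\<And>s. 0 < s \<Longrightarrow> \<phi> (matrix_inv (matrix_inv A + s *\<^sub>R matrix_inv B)) \<le> (a + s * b) / (1 + s)\<^sup>2"
  shows "\<phi> (geom_mean v A B) \<le> (1 - v) * a + v * b"
proof -
  define Z where "Z s = matrix_inv (matrix_inv A + s *\<^sub>R matrix_inv B)" for s
  have int: "set_integrable lborel {0<..} (\<lambda>s. s powr (v - 1) *\<^sub>R Z s)"
    unfolding Z_def using A B v by (intro set_integrable_resolvent sectorial_inv)
  have bl: "bounded_linear \<phi>" using \<phi> by (simp add: linear_conv_bounded_linear)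
  have \<phi>_scale: "indicator {0<..} s * (s powr (v - 1) * \<phi> (Z s)) = \<phi> (indicator {0<..} s *\<^sub>R (s powr (v - 1) *\<^sub>R Z s))" for s :: real
    by (simp add: linear_scale[OF \<phi>])
  have \<phi>_int: "set_integrable lborel {0<..} (\<lambda>s. s powr (v - 1) * \<phi> (Z s))"
    using integrable_bounded_linear[OF bl int[unfolded set_integrable_def]]
    by (simp add: set_integrable_def \<phi>_scale)
  have \<phi>_eq: "\<phi> (LBINT s:{0<..}. s powr (v - 1) *\<^sub>R Z s) = (LBINT s:{0<..}. s powr (v - 1) * \<phi> (Z s))"
    using integral_bounded_linear[OF bl int[unfolded set_integrable_def]]
    by (simp add: set_lebesgue_integral_def \<phi>_scale)
  have "\<phi> (geom_mean v A B) = sin (v * pi) / pi * (LBINT s:{0<..}. s powr (v - 1) * \<phi> (Z s))"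
    using v by (simp add: geom_mean_def linear_scale[OF \<phi>] \<phi>_eq flip: Z_def)
  also have "\<dots> \<le> sin (v * pi) / pi * (LBINT s:{0<..}. s powr (v - 1) * ((a + s * b) / (1 + s)\<^sup>2))"
  proof (intro mult_left_mono set_integral_mono \<phi>_int geometric_mean_weights(1) v)
    show "\<phi> (Z s) \<le> (a + s * b) / (1 + s)\<^sup>2" if "s \<in> {0<..}" for s
      using that le by (simp add: Z_def)
    have "0 < sin (v * pi)" using v by (intro sin_gt_zero) auto
    then show "0 \<le> sin (v * pi) / pi" by simp
  qed simp
  also have "\<dots> = (1 - v) * a + v * b" by (rule geometric_mean_weights(2)[OF v])
  finally show ?thesis .
qed

section \<open>Comparison of the quadratic forms of the means\<close>

lemma inner_mat_Re: "x \<bullet> (mat_Re A *v x) = x \<bullet> (A *v x)"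
  using inner_conj_transpose[of x A x]
  by (simp add: mat_Re_def scaleR_matrix_vector matrix_vector_mult_add_rdistrib inner_add_right inner_commute)

lemma mat_Re_self_adjoint: "(mat_Re A *v x) \<bullet> y = x \<bullet> (mat_Re A *v y)"
proof -
  have "conj_transpose (mat_Re A) = mat_Re A"
    by (simp add: mat_Re_def conj_transpose_def vec_eq_iff add.commute)
  then show ?thesis by (metis inner_conj_transpose)
qed

lemma mat_of_real_mult_vec: "mat (of_real r) *v x = r *\<^sub>R x" for x :: "complex ^ 'n::finite"
  by (simp add: mat_def matrix_vector_mult_def vec_eq_iff if_distrib[of "\<lambda>x. x * _"]
      scaleR_conv_of_real[where 'a = complex] cong: if_cong)

lemma loewner_le_mat_Re:
  assumes "mat (of_real m) \<preceq> mat_Re A"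
  shows "m * (x \<bullet> x) \<le> x \<bullet> (A *v x)"
  using assms by (auto simp: loewner_le_def pos_semidef_def Re_hdot matrix_vector_mult_diff_rdistrib
      mat_of_real_mult_vec inner_diff_right inner_mat_Re)

lemma mat_Re_loewner_le:
  assumes "mat_Re A \<preceq> mat (of_real M)"
  shows "x \<bullet> (A *v x) \<le> M * (x \<bullet> x)"
  using assms by (auto simp: loewner_le_def pos_semidef_def Re_hdot matrix_vector_mult_diff_rdistrib
      mat_of_real_mult_vec inner_diff_right inner_mat_Re)

lemma kantorovich_tangent_matrix:
  fixes A :: "('n::finite) cmat"
  assumes "0 < m" "m \<le> M" "\<And>x. m * (x \<bullet> x) \<le> x \<bullet> (A *v x)" "\<And>x. x \<bullet> (A *v x) \<le> M * (x \<bullet> x)"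
  shows "2 * (z \<bullet> w) - z \<bullet> (A *v z) \<le> ((M + m) * (w \<bullet> w) - w \<bullet> (A *v w)) / (M * m)"
  using kantorovich_tangent[of "\<lambda>x. mat_Re A *v x" m M z w] assms
  by (simp add: inner_mat_Re mat_Re_self_adjoint)

lemma form_scaleR:
  fixes A :: "('n::finite) cmat"
  shows
  "((M + m) * ((t *\<^sub>R x) \<bullet> (t *\<^sub>R x)) - (t *\<^sub>R x) \<bullet> (A *v (t *\<^sub>R x))) / (M * m) =
    t\<^sup>2 * (((M + m) * (x \<bullet> x) - x \<bullet> (A *v x)) / (M * m))"
  by (simp add: matrix_vector_scaleR power2_eq_square right_diff_distrib mult_ac)

text \<open>
  With \<open>z\<close> the inverse applied to \<open>x\<close>, the left-hand side is \<open>2 z \<bullet> x - z \<bullet> (X *v z) - s (z \<bullet> (Y *v z))\<close>.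
  Splitting \<open>x\<close> as \<open>w + s w\<close> with \<open>w = x / (1 + s)\<close> distributes the linear term between \<open>X\<close> and \<open>Y\<close>, and
  the tangent inequality applies to each.
\<close>

lemma inverse_form_le:
  assumes X: "sectorial \<alpha> X" "\<And>x. m * (x \<bullet> x) \<le> x \<bullet> (X *v x)" "\<And>x. x \<bullet> (X *v x) \<le> M * (x \<bullet> x)"
    and Y: "sectorial \<alpha> Y" "\<And>x. m * (x \<bullet> x) \<le> x \<bullet> (Y *v x)" "\<And>x. x \<bullet> (Y *v x) \<le> M * (x \<bullet> x)"
    and m: "0 < m" "m \<le> M" and s: "0 < s"
  shows "x \<bullet> (matrix_inv (X + s *\<^sub>R Y) *v x) \<le>
    (((M + m) * (x \<bullet> x) - x \<bullet> (X *v x)) / (M * m) + s * (((M + m) * (x \<bullet> x) - x \<bullet> (Y *v x)) / (M * m))) / (1 + s)\<^sup>2"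
proof -
  define z where "z = matrix_inv (X + s *\<^sub>R Y) *v x"
  define w where "w = (1 / (1 + s)) *\<^sub>R x"
  have w_form: "((M + m) * (w \<bullet> w) - w \<bullet> (Q *v w)) / (M * m) = ((M + m) * (x \<bullet> x) - x \<bullet> (Q *v x)) / (M * m) / (1 + s)\<^sup>2" for Q
    unfolding form_scaleR w_def by (simp add: power_divide)
  have "(X + s *\<^sub>R Y) *v z = x"
    unfolding z_def by (rule sectorial_inv(3)[OF sectorial_add[OF X(1) sectorial_scaleR[OF Y(1) s]]])
  then have zx: "z \<bullet> x = z \<bullet> (X *v z) + s * (z \<bullet> (Y *v z))"
    by (metis inner_add_right inner_scaleR_right matrix_vector_mult_add_rdistrib scaleR_matrix_vector)
  have zw: "z \<bullet> x = (1 + s) * (z \<bullet> w)" using s by (simp add: w_def)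
  have "x \<bullet> z = (2 * (z \<bullet> w) - z \<bullet> (X *v z)) + s * (2 * (z \<bullet> w) - z \<bullet> (Y *v z))"
    using zx zw by (simp add: inner_commute algebra_simps)
  also have "\<dots> \<le> ((M + m) * (w \<bullet> w) - w \<bullet> (X *v w)) / (M * m) + s * (((M + m) * (w \<bullet> w) - w \<bullet> (Y *v w)) / (M * m))"
    using s by (intro add_mono mult_left_mono kantorovich_tangent_matrix m X Y) auto
  also have "\<dots> = (((M + m) * (x \<bullet> x) - x \<bullet> (X *v x)) / (M * m) + s * (((M + m) * (x \<bullet> x) - x \<bullet> (Y *v x)) / (M * m))) / (1 + s)\<^sup>2"
    unfolding w_form by (simp add: add_divide_distrib)
  finally show ?thesis unfolding z_def .
qed

text \<open>
  The dual estimate, in which the bounds concern \<open>A\<close> and \<open>B\<close> instead of their inverses.  With \<open>z\<close> the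
  inverse applied to \<open>x\<close>, \<open>p = A\<inverse> z\<close> and \<open>q = B\<inverse> z\<close>, one has \<open>x = p + s q\<close> and the form of the inverse at \<open>x\<close>
  is \<open>p \<bullet> (A *v p) + s (q \<bullet> (B *v q))\<close>; the tangent inequality bounds both terms from below.  The vector
  \<open>y\<close> is a parameter to be optimised after the integration.
\<close>

lemma parallel_sum_form_ge:
  assumes A: "sectorial \<alpha> A" "\<And>x. m * (x \<bullet> x) \<le> x \<bullet> (A *v x)" "\<And>x. x \<bullet> (A *v x) \<le> M * (x \<bullet> x)"
    and B: "sectorial \<alpha> B" "\<And>x. m * (x \<bullet> x) \<le> x \<bullet> (B *v x)" "\<And>x. x \<bullet> (B *v x) \<le> M * (x \<bullet> x)"
    and m: "0 < m" "m \<le> M" and s: "0 < s"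
  shows "- (x \<bullet> (matrix_inv (matrix_inv A + s *\<^sub>R matrix_inv B) *v x)) \<le>
    ((((M + m) * (y \<bullet> y) - y \<bullet> (A *v y)) / (M * m) - 2 * (x \<bullet> y))
      + s * (((M + m) * (y \<bullet> y) - y \<bullet> (B *v y)) / (M * m) - 2 * (x \<bullet> y))) / (1 + s)\<^sup>2"
proof -
  let ?T = "matrix_inv A + s *\<^sub>R matrix_inv B"
  define z where "z = matrix_inv ?T *v x"
  define p where "p = matrix_inv A *v z"
  define q where "q = matrix_inv B *v z"
  define w where "w = (1 / (1 + s)) *\<^sub>R y"
  have w_form: "((M + m) * (w \<bullet> w) - w \<bullet> (Q *v w)) / (M * m) = ((M + m) * (y \<bullet> y) - y \<bullet> (Q *v y)) / (M * m) / (1 + s)\<^sup>2" for Q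
    unfolding form_scaleR w_def by (simp add: power_divide)
  have "?T *v z = x"
    unfolding z_def using sectorial_inv(3)[OF sectorial_add[OF sectorial_inv(5)[OF A(1)] sectorial_scaleR[OF sectorial_inv(5)[OF B(1)] s]]] .
  then have x: "x = p + s *\<^sub>R q"
    by (simp add: p_def q_def matrix_vector_mult_add_rdistrib scaleR_matrix_vector)
  have z: "A *v p = z" "B *v q = z"
    by (simp_all add: p_def q_def sectorial_inv(3)[OF A(1)] sectorial_inv(3)[OF B(1)])
  have "2 * (x \<bullet> w) - x \<bullet> z = (2 * (p \<bullet> w) - p \<bullet> (A *v p)) + s * (2 * (q \<bullet> w) - q \<bullet> (B *v q))"
    by (simp add: z x inner_add_left algebra_simps)
  also have "\<dots> \<le> ((M + m) * (w \<bullet> w) - w \<bullet> (A *v w)) / (M * m) + s * (((M + m) * (w \<bullet> w) - w \<bullet> (B *v w)) / (M * m))"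
    using s by (intro add_mono mult_left_mono kantorovich_tangent_matrix m A B) auto
  also have "\<dots> = (((M + m) * (y \<bullet> y) - y \<bullet> (A *v y)) / (M * m) + s * (((M + m) * (y \<bullet> y) - y \<bullet> (B *v y)) / (M * m))) / (1 + s)\<^sup>2"
    unfolding w_form by (simp add: add_divide_distrib)
  finally have "- (x \<bullet> z) \<le> (((M + m) * (y \<bullet> y) - y \<bullet> (A *v y)) / (M * m) + s * (((M + m) * (y \<bullet> y) - y \<bullet> (B *v y)) / (M * m))) / (1 + s)\<^sup>2 - 2 * (x \<bullet> w)"
    by simp
  also have "2 * (x \<bullet> w) = (1 + s) * (2 * (x \<bullet> y)) / (1 + s)\<^sup>2"
    using s by (simp add: w_def power2_eq_square)
  finally show ?thesis
    unfolding z_def by (simp add: algebra_simps add_divide_distrib diff_divide_distrib)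
qed

lemma linear_form: "linear (\<lambda>Z. y \<bullet> (Z *v x))" for x y :: "complex ^ 'n::finite"
  by (rule linearI) (simp_all add: matrix_vector_mult_add_rdistrib inner_add_right scaleR_matrix_vector)

text \<open>
  The estimate for sectorial matrices is linear in the matrix, so it passes from the inverses to
  their integral.
\<close>

lemma geom_mean_form_le:
  assumes A: "sectorial \<alpha> A" and B: "sectorial \<alpha> B" and v: "0 < v" "v < 1" and \<alpha>: "0 \<le> \<alpha>" "\<alpha> < pi / 2"
  shows "y \<bullet> (geom_mean v A B *v x) \<le> (x \<bullet> (geom_mean v A B *v x) + y \<bullet> (geom_mean v A B *v y)) / (2 * cos \<alpha>)"
proof -
  define \<phi> where "\<phi> Z = y \<bullet> (Z *v x) - (1 / (2 * cos \<alpha>)) *\<^sub>R (x \<bullet> (Z *v x) + y \<bullet> (Z *v y))" for Z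
  have "linear \<phi>"
    unfolding \<phi>_def by (intro linear_compose_sub linear_compose_scale_right linear_compose_add linear_form)
  then have "\<phi> (geom_mean v A B) \<le> (1 - v) * 0 + v * 0"
  proof (rule functional_geom_mean_le[OF A B v])
    fix s :: real assume "0 < s"
    then have "sectorial \<alpha> (matrix_inv (matrix_inv A + s *\<^sub>R matrix_inv B))"
      by (intro sectorial_inv sectorial_add sectorial_scaleR A B)
    from sectorial_form_le[OF this \<alpha>]
    show "\<phi> (matrix_inv (matrix_inv A + s *\<^sub>R matrix_inv B)) \<le> (0 + s * 0) / (1 + s)\<^sup>2"
      by (simp add: \<phi>_def)
  qed
  then show ?thesis by (simp add: \<phi>_def)
qed

section \<open>Comparison of the norms of the means\<close>

lemma kantorovich_eq: "0 < m \<Longrightarrow> 0 < M \<Longrightarrow> kantorovich (M / m) = ((M + m) / 2)\<^sup>2 / (M * m)"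
  by (simp add: kantorovich_def field_simps power2_eq_square)

lemma kantorovich_ge_1: "0 < h \<Longrightarrow> 1 \<le> kantorovich h"
  using zero_le_power2[of "h - 1"] by (simp add: kantorovich_def field_simps power2_eq_square)

text \<open>
  A comparison of quadratic forms on the diagonal is enough for sectorial matrices, at the price of
  one factor \<open>sec \<alpha>\<close>.
\<close>

lemma norm_le_if_sector_form_le:
  fixes A H :: "('n::finite) cmat"
  assumes N: "unitarily_invariant_norm N" and cos: "0 < cos \<alpha>" and c: "0 \<le> c"
    and A: "\<And>x y. y \<bullet> (A *v x) \<le> (x \<bullet> (A *v x) + y \<bullet> (A *v y)) / (2 * cos \<alpha>)"
    and le: "\<And>x. x \<bullet> (A *v x) \<le> c * (x \<bullet> (H *v x))"
  shows "N A \<le> sec \<alpha> * c * N H"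
proof -
  have "N A \<le> N ((sec \<alpha> * c) *\<^sub>R H)"
  proof (rule norm_le_if_form_le[OF N])
    fix x y
    have "y \<bullet> (A *v x) \<le> (c * (x \<bullet> (H *v x)) + c * (y \<bullet> (H *v y))) / (2 * cos \<alpha>)"
      by (rule order_trans[OF A]) (use cos le[of x] le[of y] in \<open>simp add: divide_right_mono\<close>)
    then show "y \<bullet> (A *v x) \<le> (x \<bullet> ((sec \<alpha> * c) *\<^sub>R H *v x) + y \<bullet> ((sec \<alpha> * c) *\<^sub>R H *v y)) / 2"
      using cos by (simp add: scaleR_matrix_vector sec_def field_simps)
  qed
  then show ?thesis
    using c cos by (simp add: norm_mat_scaleR[OF N] sec_def)
qed

text \<open>
  Let \<open>C\<close> be the arithmetic mean of the inverses, so that the harmonic mean is \<open>C\<inverse>\<close>, and let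
  \<open>c = (M + m) / 2\<close>.  Integrating the bound for the inverses yields the form of
  \<open>(2 c I - C) / (M m)\<close> as an upper bound for that of the geometric mean.  The sectorial estimate for \<open>C\<close> at
  \<open>x\<close> and a multiple of \<open>C\<inverse> x\<close> bounds \<open>2 c (x \<bullet> x) - x \<bullet> (C *v x)\<close> by \<open>c\<^sup>2 sec\<^sup>2 \<alpha>\<close> times the form of \<open>C\<inverse>\<close>, and
  \<open>c\<^sup>2 / (M m)\<close> is the Kantorovich constant.
\<close>

theorem geom_mean_le_harm_mean:
  fixes A B :: "('n::finite) cmat"
  assumes N: "unitarily_invariant_norm N" and \<alpha>: "0 \<le> \<alpha>" "\<alpha> < pi / 2"
    and A: "sectorial \<alpha> A" and B: "sectorial \<alpha> B" and v: "0 < v" "v < 1" and m: "0 < m" "m \<le> M"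
    and X: "\<And>x. m * (x \<bullet> x) \<le> x \<bullet> (matrix_inv A *v x)" "\<And>x. x \<bullet> (matrix_inv A *v x) \<le> M * (x \<bullet> x)"
    and Y: "\<And>x. m * (x \<bullet> x) \<le> x \<bullet> (matrix_inv B *v x)" "\<And>x. x \<bullet> (matrix_inv B *v x) \<le> M * (x \<bullet> x)"
  shows "N (geom_mean v A B) \<le> sec \<alpha> ^ 3 * kantorovich (M / m) * N (harm_mean v A B)"
proof -
  define C where "C = (1 - v) *\<^sub>R matrix_inv A + v *\<^sub>R matrix_inv B"
  define c where "c = (M + m) / 2"
  have C_form: "x \<bullet> (C *v x) = (1 - v) * (x \<bullet> (matrix_inv A *v x)) + v * (x \<bullet> (matrix_inv B *v x))" for x
    by (simp only: C_def matrix_vector_mult_add_rdistrib scaleR_matrix_vector inner_add_right inner_scaleR_right)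
  have C: "sectorial \<alpha> C"
    unfolding C_def using v by (intro sectorial_add sectorial_scaleR sectorial_inv A B) auto
  have cos: "0 < cos \<alpha>" using \<alpha> by (intro cos_gt_zero_pi) auto
  have sec: "0 < sec \<alpha>" using cos by (simp add: sec_def)
  have K: "kantorovich (M / m) = c\<^sup>2 / (M * m)" using m by (simp add: kantorovich_eq c_def)
  have form: "x \<bullet> (geom_mean v A B *v x) \<le> (kantorovich (M / m) * (sec \<alpha>)\<^sup>2) * (x \<bullet> (harm_mean v A B *v x))" for x
  proof -
    have "x \<bullet> (geom_mean v A B *v x) \<le>
        (1 - v) * (((M + m) * (x \<bullet> x) - x \<bullet> (matrix_inv A *v x)) / (M * m))
        + v * (((M + m) * (x \<bullet> x) - x \<bullet> (matrix_inv B *v x)) / (M * m))"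
      by (rule functional_geom_mean_le[OF A B v linear_form])
         (rule inverse_form_le[OF sectorial_inv(5)[OF A] X sectorial_inv(5)[OF B] Y m])
    also have "\<dots> = (2 * c * (x \<bullet> x) - x \<bullet> (C *v x)) / (M * m)"
      unfolding C_form using m by (simp add: c_def field_simps)
    finally have 1: "x \<bullet> (geom_mean v A B *v x) \<le> (2 * c * (x \<bullet> x) - x \<bullet> (C *v x)) / (M * m)" .
    define z where "z = harm_mean v A B *v x"
    have x: "C *v z = x"
      unfolding z_def harm_mean_def C_def[symmetric] by (rule sectorial_inv(3)[OF C])
    \<comment> \<open>The multiple \<open>c sec \<alpha>\<close> balances the two terms on the right.\<close>
    have "x \<bullet> (C *v ((c * sec \<alpha>) *\<^sub>R z)) \<le> (((c * sec \<alpha>) *\<^sub>R z) \<bullet> (C *v ((c * sec \<alpha>) *\<^sub>R z)) + x \<bullet> (C *v x)) / (2 * cos \<alpha>)"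
      by (rule sectorial_form_le[OF C \<alpha>])
    then have "c * sec \<alpha> * (x \<bullet> x) \<le> ((c * sec \<alpha>)\<^sup>2 * (x \<bullet> z) + x \<bullet> (C *v x)) / (2 * cos \<alpha>)"
      by (simp add: matrix_vector_scaleR x power2_eq_square inner_commute[of z x] mult_ac)
    then have "2 * c * (x \<bullet> x) - x \<bullet> (C *v x) \<le> (c * sec \<alpha>)\<^sup>2 * (x \<bullet> z)"
      using cos by (simp add: sec_def field_simps)
    then have "(2 * c * (x \<bullet> x) - x \<bullet> (C *v x)) / (M * m) \<le> (c * sec \<alpha>)\<^sup>2 * (x \<bullet> z) / (M * m)"
      using m by (intro divide_right_mono) auto
    with 1 show ?thesis by (simp add: K z_def power_mult_distrib)
  qed
  have "N (geom_mean v A B) \<le> sec \<alpha> * (kantorovich (M / m) * (sec \<alpha>)\<^sup>2) * N (harm_mean v A B)"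
    by (rule norm_le_if_sector_form_le[OF N cos _ geom_mean_form_le[OF A B v \<alpha>] form])
       (use m in \<open>simp add: K\<close>)
  then show ?thesis by (simp add: power2_eq_square power3_eq_cube mult_ac)
qed

text \<open>
  Let \<open>C\<close> be the arithmetic mean, \<open>W\<close> its real part and \<open>c = (M + m) / 2\<close>.  For every \<open>y\<close>,
  the form of the geometric mean at \<open>x\<close> is at least
  \<open>2 x \<bullet> y - (2 c (y \<bullet> y) - y \<bullet> (C *v y)) / (M m)\<close>.  The choice \<open>y = k W x\<close>, where \<open>k = M m / c\<^sup>2\<close> is the reciprocal
  Kantorovich constant, makes this at least \<open>k (x \<bullet> (C *v x))\<close>, because
  \<open>(c - W) W (c - W)\<close> is positive semidefinite.
\<close>

theorem arith_mean_le_geom_mean: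
  fixes A B :: "('n::finite) cmat"
  assumes N: "unitarily_invariant_norm N" and \<alpha>: "0 \<le> \<alpha>" "\<alpha> < pi / 2"
    and A: "sectorial \<alpha> A" and B: "sectorial \<alpha> B" and v: "0 < v" "v < 1" and m: "0 < m" "m \<le> M"
    and A_bd: "\<And>x. m * (x \<bullet> x) \<le> x \<bullet> (A *v x)" "\<And>x. x \<bullet> (A *v x) \<le> M * (x \<bullet> x)"
    and B_bd: "\<And>x. m * (x \<bullet> x) \<le> x \<bullet> (B *v x)" "\<And>x. x \<bullet> (B *v x) \<le> M * (x \<bullet> x)"
  shows "N (arith_mean v A B) \<le> sec \<alpha> * kantorovich (M / m) * N (geom_mean v A B)"
proof -
  define C where "C = arith_mean v A B"
  define c where "c = (M + m) / 2"
  have C_form: "x \<bullet> (C *v x) = (1 - v) * (x \<bullet> (A *v x)) + v * (x \<bullet> (B *v x))" for x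
    by (simp only: C_def arith_mean_def matrix_vector_mult_add_rdistrib scaleR_matrix_vector inner_add_right inner_scaleR_right)
  define k where "k = M * m / c\<^sup>2"
  have pos: "0 < c" "0 < M * m" "0 < k" using m by (simp_all add: c_def k_def)
  have C: "sectorial \<alpha> C"
    unfolding C_def arith_mean_def using v by (intro sectorial_add sectorial_scaleR A B) auto
  have cos: "0 < cos \<alpha>" using \<alpha> by (intro cos_gt_zero_pi) auto
  have K: "kantorovich (M / m) = 1 / k" using m by (simp add: kantorovich_eq c_def k_def)
  have C_pos: "0 \<le> x \<bullet> (C *v x)" for x
    using sectorial_pos[OF C, of x] by (cases "x = 0") auto
  have form: "x \<bullet> (C *v x) \<le> kantorovich (M / m) * (x \<bullet> (geom_mean v A B *v x))" for x
  proof -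
    define w where "w = mat_Re C *v x"
    define y where "y = k *\<^sub>R w"
    have xw: "x \<bullet> w = x \<bullet> (C *v x)" by (simp add: w_def inner_mat_Re)
    have "- (x \<bullet> (geom_mean v A B *v x)) \<le>
        (1 - v) * (((M + m) * (y \<bullet> y) - y \<bullet> (A *v y)) / (M * m) - 2 * (x \<bullet> y))
        + v * (((M + m) * (y \<bullet> y) - y \<bullet> (B *v y)) / (M * m) - 2 * (x \<bullet> y))"
      by (rule functional_geom_mean_le[OF A B v linear_compose_neg[OF linear_form]])
         (rule parallel_sum_form_ge[OF A A_bd B B_bd m])
    also have "\<dots> = (2 * c * (y \<bullet> y) - y \<bullet> (C *v y)) / (M * m) - 2 * (x \<bullet> y)"
      unfolding C_form using m by (simp add: c_def field_simps)
    also have "2 * c * (y \<bullet> y) - y \<bullet> (C *v y) = k\<^sup>2 * (2 * c * (w \<bullet> w) - w \<bullet> (C *v w))"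
      by (simp add: y_def matrix_vector_scaleR power2_eq_square algebra_simps)
    also have "2 * c * (w \<bullet> w) - w \<bullet> (C *v w) \<le> c\<^sup>2 * (x \<bullet> (C *v x))"
      using kantorovich_square[of "\<lambda>x. mat_Re C *v x" c x] C_pos
      by (simp add: inner_mat_Re mat_Re_self_adjoint xw flip: w_def)
    then have "k\<^sup>2 * (2 * c * (w \<bullet> w) - w \<bullet> (C *v w)) / (M * m) \<le> k\<^sup>2 * (c\<^sup>2 * (x \<bullet> (C *v x))) / (M * m)"
      using pos by (intro divide_right_mono mult_left_mono) auto
    also have "\<dots> = k * (x \<bullet> (C *v x))"
      using pos m by (simp add: k_def power2_eq_square)
    also have "2 * (x \<bullet> y) = 2 * k * (x \<bullet> (C *v x))" by (simp add: y_def xw)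
    finally show ?thesis using pos by (simp add: K field_simps)
  qed
  have "N C \<le> sec \<alpha> * kantorovich (M / m) * N (geom_mean v A B)"
    by (rule norm_le_if_sector_form_le[OF N cos _ sectorial_form_le[OF C \<alpha>] form])
       (use pos in \<open>simp add: K\<close>)
  then show ?thesis by (simp add: C_def)
qed

lemma matrix_inv_matrix_inv:
  assumes "sectorial \<alpha> A"
  shows "matrix_inv (matrix_inv A) = A"
proof -
  have "matrix_inv (matrix_inv A) = (A ** matrix_inv A) ** matrix_inv (matrix_inv A)"
    by (simp add: sectorial_inv[OF assms])
  also have "\<dots> = A"
    by (simp add: sectorial_inv(1)[OF sectorial_inv(5)[OF assms]] flip: matrix_mul_assoc)
  finally show ?thesis .
qed

theorem corollary3p3:
  fixes A B :: "complex ^ 'n ^ 'n"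
    and N :: "complex ^ 'n ^ 'n \<Rightarrow> real"
    and \<alpha> v m M h :: real
  assumes "0 \<le> \<alpha>" and "\<alpha> < pi / 2"
    and "0 \<le> v" and "v \<le> 1"
    and "0 < m" and "m \<le> M" and "h = M / m"
    and "numerical_range A \<subseteq> sector \<alpha>" and "numerical_range B \<subseteq> sector \<alpha>"
    and "unitarily_invariant_norm N"
  shows
    "(mat (of_real m) \<preceq> mat_Re (matrix_inv A) \<and> mat_Re (matrix_inv A) \<preceq> mat (of_real M) \<and>
      mat (of_real m) \<preceq> mat_Re (matrix_inv B) \<and> mat_Re (matrix_inv B) \<preceq> mat (of_real M)
      \<longrightarrow> N (geom_mean v A B) \<le> sec \<alpha> ^ 5 * kantorovich h * N (harm_mean v A B))
     \<and>
     (mat (of_real m) \<preceq> mat_Re A \<and> mat_Re A \<preceq> mat (of_real M) \<and>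
      mat (of_real m) \<preceq> mat_Re B \<and> mat_Re B \<preceq> mat (of_real M)
      \<longrightarrow> N (geom_mean v A B) \<ge> cos \<alpha> ^ 5 * inverse (kantorovich h) * N (arith_mean v A B))"
proof -
  have A: "sectorial \<alpha> A" and B: "sectorial \<alpha> B"
    using assms by (simp_all add: sectorial_if_numerical_range)
  have cos: "0 < cos \<alpha>" "cos \<alpha> \<le> 1" using assms by (auto intro: cos_gt_zero_pi)
  then have sec: "1 \<le> sec \<alpha>" by (simp add: sec_def)
  have K: "1 \<le> kantorovich h" using assms by (intro kantorovich_ge_1) simp
  have N: "0 \<le> N X" for X
    using assms(10) by (simp add: unitarily_invariant_norm_def is_matrix_norm_def)
  have harm: "N (geom_mean v A B) \<le> sec \<alpha> ^ 5 * kantorovich h * N (harm_mean v A B)"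
    if "N (geom_mean v A B) \<le> sec \<alpha> ^ k * kantorovich h * N (harm_mean v A B)" "k \<le> 5" for k
  proof -
    have "sec \<alpha> ^ k * kantorovich h * N (harm_mean v A B) \<le> sec \<alpha> ^ 5 * kantorovich h * N (harm_mean v A B)"
      using K sec N that(2) by (intro mult_right_mono power_increasing) auto
    with that(1) show ?thesis by linarith
  qed
  have arith: "cos \<alpha> ^ 5 * inverse (kantorovich h) * N (arith_mean v A B) \<le> N (geom_mean v A B)"
    if "N (arith_mean v A B) \<le> sec \<alpha> * kantorovich h * N (geom_mean v A B)"
  proof -
    have "cos \<alpha> ^ 5 * inverse (kantorovich h) * N (arith_mean v A B)
        \<le> cos \<alpha> ^ 1 * inverse (kantorovich h) * N (arith_mean v A B)"
      using cos K N by (intro mult_right_mono power_decreasing) auto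
    also have "\<dots> \<le> N (geom_mean v A B)"
      using that cos K by (simp add: sec_def field_simps)
    finally show ?thesis .
  qed
  have K_N: "N X \<le> c * kantorovich h * N X" if "1 \<le> c" for c X
  proof -
    have "1 * 1 \<le> c * kantorovich h" using that K by (intro mult_mono) auto
    from mult_right_mono[OF this N[of X]] show ?thesis by simp
  qed
  consider "v = 0" | "v = 1" | "0 < v" "v < 1" using assms(3,4) by linarith
  then show ?thesis
  proof cases
    \<comment> \<open>At the end points the three means coincide, and \<open>sec \<alpha> K(h) \<ge> 1\<close> suffices.\<close>
    case 1
    then have "harm_mean v A B = geom_mean v A B" "arith_mean v A B = geom_mean v A B"
      by (simp_all add: harm_mean_def arith_mean_def geom_mean_def matrix_inv_matrix_inv[OF A])
    then show ?thesis
      using harm[of 1] arith K_N[OF sec] by simp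
  next
    case 2
    then have "harm_mean v A B = geom_mean v A B" "arith_mean v A B = geom_mean v A B"
      by (simp_all add: harm_mean_def arith_mean_def geom_mean_def matrix_inv_matrix_inv[OF B])
    then show ?thesis
      using harm[of 1] arith K_N[OF sec] by simp
  next
    case 3
    show ?thesis
    proof (intro conjI impI; elim conjE)
      assume "mat (of_real m) \<preceq> mat_Re (matrix_inv A)" "mat_Re (matrix_inv A) \<preceq> mat (of_real M)"
        "mat (of_real m) \<preceq> mat_Re (matrix_inv B)" "mat_Re (matrix_inv B) \<preceq> mat (of_real M)"
      from geom_mean_le_harm_mean[OF assms(10) assms(1,2) A B 3 assms(5,6)
          loewner_le_mat_Re[OF this(1)] mat_Re_loewner_le[OF this(2)]
          loewner_le_mat_Re[OF this(3)] mat_Re_loewner_le[OF this(4)]]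
      show "N (geom_mean v A B) \<le> sec \<alpha> ^ 5 * kantorovich h * N (harm_mean v A B)"
        unfolding assms(7)[symmetric] by (rule harm) simp
    next
      assume "mat (of_real m) \<preceq> mat_Re A" "mat_Re A \<preceq> mat (of_real M)"
        "mat (of_real m) \<preceq> mat_Re B" "mat_Re B \<preceq> mat (of_real M)"
      from arith_mean_le_geom_mean[OF assms(10) assms(1,2) A B 3 assms(5,6)
          loewner_le_mat_Re[OF this(1)] mat_Re_loewner_le[OF this(2)]
          loewner_le_mat_Re[OF this(3)] mat_Re_loewner_le[OF this(4)]]
      show "cos \<alpha> ^ 5 * inverse (kantorovich h) * N (arith_mean v A B) \<le> N (geom_mean v A B)"
        unfolding assms(7)[symmetric] by (rule arith)
    qed
  qed
qed

end
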